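(* Let $A$ be a $C^*$-algebra and let $I \subseteq A$ be a semiprime ideal (two-sided, not necessarily norm-closed). Then $I$ is positively spanned (hence self-adjoint, $I = I^*$, and closed under multiplication by complex scalars) and hereditary.
   Context: $C^*$-algebras are not assumed unital, and $A_+$ denotes the set of positive elements of $A$. An ideal in a $C^*$-algebra $A$ is an additive subgroup $I \subseteq A$ with $aI \cup Ia \subseteq I$ for all $a \in A$; it is not assumed norm-closed, self-adjoint, or closed under complex scalars. For ideals $J,K$, $JK$ is the additive subgroup generated by products $xy$ with $x \in J$, $y \in K$, and $J^2 = JJ$. An ideal $I$ is semiprime if for all ideals $J \subseteq A$, $J^2 \subseteq I$ implies $J \subseteq I$. Write $I_+ := I \cap A_+$. The ideal $I$ is positively spanned if it equals the complex linear span of $I_+$. It is hereditary if whenever $a \in A$ and $x \in I$ satisfy $0 \leq a \leq x$, then $a \in I$. *)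

theory Defs
  imports "HOL-Analysis.Analysis" "HOL-Computational_Algebra.Group_Closure"
begin

section \<open>\<open>C\<^sup>*\<close>-algebras, not necessarily unital\<close>

text \<open>
  \<^class>\<open>real_normed_algebra\<close> has no unit (and allows the zero algebra), and it already provides
  submultiplicativity of the norm; \<^class>\<open>banach\<close> provides completeness.
\<close>

class cstar_algebra = real_normed_algebra + banach +
  fixes scaleC :: "complex \<Rightarrow> 'a \<Rightarrow> 'a" (infixr "*\<^sub>C" 75)
    and adj :: "'a \<Rightarrow> 'a"
  assumes scaleC_add_right: "c *\<^sub>C (x + y) = c *\<^sub>C x + c *\<^sub>C y"
    and scaleC_add_left: "(c + d) *\<^sub>C x = c *\<^sub>C x + d *\<^sub>C x"
    and scaleC_scaleC: "c *\<^sub>C d *\<^sub>C x = (c * d) *\<^sub>C x"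
    and scaleR_scaleC: "r *\<^sub>R x = complex_of_real r *\<^sub>C x"
    and mult_scaleC_left: "(c *\<^sub>C x) * y = c *\<^sub>C (x * y)"
    and mult_scaleC_right: "x * (c *\<^sub>C y) = c *\<^sub>C (x * y)"
    and norm_scaleC: "norm (c *\<^sub>C x) = norm c * norm x"
    and adj_adj: "adj (adj x) = x"
    and adj_add: "adj (x + y) = adj x + adj y"
    and adj_scaleC: "adj (c *\<^sub>C x) = cnj c *\<^sub>C adj x"
    and adj_mult: "adj (x * y) = adj y * adj x"
    and cstar_identity: "norm (adj x * x) = (norm x)\<^sup>2"

global_interpretation complex_vector: vector_space "scaleC :: complex \<Rightarrow> 'a \<Rightarrow> 'a::cstar_algebra"
proof
  fix x :: 'a
  show "1 *\<^sub>C x = x"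
    using scaleR_scaleC [of 1 x] by simp
qed (simp_all add: scaleC_add_right scaleC_add_left scaleC_scaleC)


section \<open>Positive elements\<close>

text \<open>Multiplication of the unitization \<open>A \<oplus> \<complex>\<close>, whose unit is \<open>(0, 1)\<close>:\<close>

definition unitization_mult ::
    "'a::cstar_algebra \<times> complex \<Rightarrow> 'a \<times> complex \<Rightarrow> 'a \<times> complex" where
  "unitization_mult p q =
    (fst p * fst q + snd p *\<^sub>C fst q + snd q *\<^sub>C fst p, snd p * snd q)"

definition unitization_invertible :: "'a::cstar_algebra \<times> complex \<Rightarrow> bool" where
  "unitization_invertible p \<longleftrightarrow>
    (\<exists>q. unitization_mult p q = (0, 1) \<and> unitization_mult q p = (0, 1))"

text \<open>
  The spectrum of \<open>a\<close> is taken in \<open>A \<oplus> \<complex>\<close> even when \<open>A\<close> has a unit. In that case it is the usual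
  spectrum together with \<open>0\<close>, so whether it is contained in \<open>[0, \<infinity>)\<close> is not affected.
\<close>

definition unitized_spectrum :: "'a::cstar_algebra \<Rightarrow> complex set" where
  "unitized_spectrum a = {z. \<not> unitization_invertible (a, - z)}"

definition positive_elements :: "'a::cstar_algebra set" where
  "positive_elements = {a. adj a = a \<and> unitized_spectrum a \<subseteq> complex_of_real ` {0..}}"

definition cstar_le :: "'a::cstar_algebra \<Rightarrow> 'a \<Rightarrow> bool" (infix "\<sqsubseteq>" 50) where
  "a \<sqsubseteq> b \<longleftrightarrow> b - a \<in> positive_elements"


section \<open>Ideals\<close>

text \<open>
  Ideals are only additive subgroups; they need not be closed in norm, under \<^const>\<open>adj\<close> or under
  scalars.
\<close>

definition is_ideal :: "'a::cstar_algebra set \<Rightarrow> bool" where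
  "is_ideal I \<longleftrightarrow>
    0 \<in> I \<and> (\<forall>x\<in>I. \<forall>y\<in>I. x - y \<in> I) \<and> (\<forall>a. \<forall>x\<in>I. a * x \<in> I \<and> x * a \<in> I)"

definition ideal_mult :: "'a::cstar_algebra set \<Rightarrow> 'a set \<Rightarrow> 'a set" where
  "ideal_mult J K = group_closure {x * y | x y. x \<in> J \<and> y \<in> K}"

definition semiprime_ideal :: "'a::cstar_algebra set \<Rightarrow> bool" where
  "semiprime_ideal I \<longleftrightarrow>
    is_ideal I \<and> (\<forall>J. is_ideal J \<longrightarrow> ideal_mult J J \<subseteq> I \<longrightarrow> J \<subseteq> I)"

definition positively_spanned :: "'a::cstar_algebra set \<Rightarrow> bool" where
  "positively_spanned I \<longleftrightarrow> I = complex_vector.span (I \<inter> positive_elements)"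

definition hereditary :: "'a::cstar_algebra set \<Rightarrow> bool" where
  "hereditary I \<longleftrightarrow> (\<forall>a. \<forall>x\<in>I. 0 \<sqsubseteq> a \<and> a \<sqsubseteq> x \<longrightarrow> a \<in> I)"

end

theory Submission
  imports Defs
begin

text \<open>
  Let \<open>A\<close> be the algebra and \<open>I\<close> a semiprime ideal. An element \<open>x\<close> with \<open>x A x \<subseteq> I\<close> lies in \<open>I\<close>;
  in particular \<open>I\<close> is closed under complex scalars, so it is also an ideal of the unitization. If
  \<open>k \<ge> 0\<close> and \<open>k\<^sup>2\<^sup>n \<in> I\<close>, then \<open>k\<^sup>n\<^sup>+\<^sup>1 \<in> I\<close>: for each \<open>w\<close> the square root \<open>d\<close> of the positive element
  \<open>k\<^sup>n\<^sup>+\<^sup>1 w\<^sup>* w k\<^sup>n\<^sup>+\<^sup>1\<close> factors as \<open>d = u k\<^sup>n\<close>, hence \<open>d\<^sup>2 = u k\<^sup>2\<^sup>n u\<^sup>* \<in> I\<close>. Applying this to an eighth root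
  shows that \<open>I\<close> is closed under square roots of positive elements. Therefore every \<open>x \<in> I\<close> is of
  the form \<open>u k\<^sup>3\<close> with \<open>0 \<le> k \<in> I\<close>, so \<open>x\<^sup>* \<in> I\<close>, and polarization writes \<open>x = (u k) k\<^sup>2\<close> as a
  combination of elements \<open>w\<^sup>* w\<close> with \<open>w \<in> I\<close>. If \<open>0 \<le> a \<le> k\<^sup>4 \<in> I\<close>, then \<open>a\<^sup>1\<^sup>/\<^sup>2\<close> is a left
  multiple of \<open>k\<close>, which gives heredity.
\<close>

section \<open>Basic facts on \<open>C\<^sup>*\<close>-algebras\<close>

lemmas scaleC_minus_right = complex_vector.scale_minus_right
  and scaleC_minus_left = complex_vector.scale_minus_left
  and scaleC_diff_right = complex_vector.scale_right_diff_distrib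
  and scaleC_diff_left = complex_vector.scale_left_diff_distrib

lemma adj_zero [simp]: "adj (0::'a::cstar_algebra) = 0"
  using adj_add [of "0::'a" 0] by simp

lemma adj_minus: "adj (- x) = - adj (x::'a::cstar_algebra)"
  using adj_add [of x "- x"] by (simp add: add_eq_0_iff2)

lemma adj_diff: "adj (x - y) = adj x - adj (y::'a::cstar_algebra)"
  using adj_add [of x "- y"] by (simp add: adj_minus)

lemma adj_scaleR: "adj (r *\<^sub>R x) = r *\<^sub>R adj (x::'a::cstar_algebra)"
  by (simp add: scaleR_scaleC adj_scaleC)

lemmas scaleC_simps = scaleC_add_right scaleC_add_left scaleC_minus_right scaleC_minus_left
  scaleC_diff_right scaleC_diff_left scaleC_scaleC mult_scaleC_left mult_scaleC_right

lemmas adj_simps = adj_adj adj_add adj_minus adj_diff adj_scaleR adj_scaleC adj_mult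

lemma norm_adj [simp]: "norm (adj x) = norm (x::'a::cstar_algebra)"
proof -
  have "norm y \<le> norm (adj y)" for y :: 'a
  proof (cases "y = 0")
    case False
    have "norm y * norm y \<le> norm (adj y) * norm y"
      using norm_mult_ineq [of "adj y" y] by (simp add: cstar_identity power2_eq_square)
    with False show ?thesis by simp
  qed simp
  from this [of x] this [of "adj x"] show ?thesis by (simp add: adj_adj)
qed

lemma cstar_identity': "norm (x * adj x) = (norm (x::'a::cstar_algebra))\<^sup>2"
  using cstar_identity [of "adj x"] by (simp add: adj_adj)

lemma bounded_linear_adj: "bounded_linear (adj :: 'a::cstar_algebra \<Rightarrow> 'a)"
  by (rule bounded_linear_intro [where K = 1]) (simp_all add: adj_simps)

lemmas tendsto_adj = bounded_linear.tendsto [OF bounded_linear_adj]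

lemma norm_self_adjoint_square:
  "adj c = c \<Longrightarrow> norm (c * c) = (norm (c::'a::cstar_algebra))\<^sup>2"
  using cstar_identity [of c] by simp

lemma self_adjoint_square_eq_0:
  fixes c :: "'a::cstar_algebra"
  assumes "adj c = c" "c * c = 0"
  shows "c = 0"
  using norm_self_adjoint_square [OF assms(1)] assms(2) by simp

text \<open>Serves twice: to reduce a test on all \<open>p\<close> to elements
  \<open>adj w * w\<close>, and to expand a product \<open>adj s * t\<close> of ideal elements into
  positive elements of the ideal.\<close>

lemma polarization:
  fixes s t :: "'a::cstar_algebra"
  shows "4 *\<^sub>C (adj s * t) = (adj (t + s) * (t + s) - adj (t - s) * (t - s))
    + \<i> *\<^sub>C (adj (t + \<i> *\<^sub>C s) * (t + \<i> *\<^sub>C s) - adj (t - \<i> *\<^sub>C s) * (t - \<i> *\<^sub>C s))"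
proof -
  have "4 *\<^sub>C x = x + x + x + x" for x :: 'a
    using scaleC_add_left [of 2 2 x] scaleC_add_left [of 1 1 x] by (simp add: add.assoc)
  then show ?thesis
    by (simp add: adj_simps algebra_simps scaleC_add_right scaleC_diff_right scaleC_scaleC
        mult_scaleC_left mult_scaleC_right scaleC_minus_left)
qed

section \<open>The unitization\<close>

datatype 'a unitization = Unitization (alg_part: 'a) (scalar_part: complex)

text \<open>The action of the unitization on \<open>A\<close> by left multiplication; its operator
  norm is the main part of the norm below.\<close>

definition left_op :: "'a::cstar_algebra unitization \<Rightarrow> 'a \<Rightarrow> 'a" where
  "left_op p b = alg_part p * b + scalar_part p *\<^sub>C b"

lemma bounded_linear_left_op: "bounded_linear (left_op p)"
proof -
  have "bounded_linear (\<lambda>b. z *\<^sub>C (b::'a))" for z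
    by (rule bounded_linear_intro [where K = "cmod z"])
      (simp_all add: scaleC_add_right scaleR_scaleC scaleC_scaleC norm_scaleC mult.commute)
  then show ?thesis
    unfolding left_op_def by (intro bounded_linear_add bounded_linear_mult_right)
qed

lemma norm_left_op_le: "norm (left_op p b) \<le> onorm (left_op p) * norm b"
  by (rule onorm [OF bounded_linear_left_op])

text \<open>Evaluating \<open>left_op p\<close> at \<open>adj a\<close>, for \<open>a\<close> the
  algebra part, produces \<open>a * adj a\<close>, of norm \<open>(norm a)^2\<close>; one factor
  \<open>norm a\<close> cancels. Definiteness and completeness of the norm rest on this
  bound.\<close>

lemma norm_alg_part_le: "norm (alg_part p) \<le> onorm (left_op p) + cmod (scalar_part p)"
proof (cases "alg_part p = 0")
  case False
  let ?a = "alg_part p"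
  have "?a * adj ?a = left_op p (adj ?a) - scalar_part p *\<^sub>C adj ?a"
    by (simp add: left_op_def)
  then have "(norm ?a)\<^sup>2 \<le> onorm (left_op p) * norm ?a + cmod (scalar_part p) * norm ?a"
    using norm_triangle_ineq4 [of "left_op p (adj ?a)" "scalar_part p *\<^sub>C adj ?a"]
      norm_left_op_le [of p "adj ?a"]
    by (simp add: norm_scaleC flip: cstar_identity')
  then have "norm ?a * norm ?a \<le> (onorm (left_op p) + cmod (scalar_part p)) * norm ?a"
    by (simp add: power2_eq_square algebra_simps)
  with False show ?thesis by simp
qed (simp add: onorm_pos_le bounded_linear_left_op)

lemma onorm_left_op_le: "onorm (left_op p) \<le> norm (alg_part p) + cmod (scalar_part p)"
proof (rule onorm_bound)
  fix b
  show "norm (left_op p b) \<le> (norm (alg_part p) + cmod (scalar_part p)) * norm b"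
    unfolding left_op_def
    by (rule norm_triangle_le)
      (auto simp: norm_scaleC distrib_right intro!: add_mono norm_mult_ineq)
qed simp

text \<open>
  The operator norm alone vanishes at \<open>(- e, 1)\<close> if the algebra has a unit \<open>e\<close>;
  the maximum with the norm of the scalar part is always a \<open>C\<^sup>*\<close>-norm.
\<close>

instantiation unitization :: (cstar_algebra) real_normed_algebra_1
begin

definition "0 = Unitization 0 0"
definition "1 = Unitization 0 1"
definition "p + q = Unitization (alg_part p + alg_part q) (scalar_part p + scalar_part q)"
definition "p - q = Unitization (alg_part p - alg_part q) (scalar_part p - scalar_part q)"
definition "- p = Unitization (- alg_part p) (- scalar_part p)"
definition "p * q = Unitization
  (alg_part p * alg_part q + scalar_part p *\<^sub>C alg_part q + scalar_part q *\<^sub>C alg_part p)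
  (scalar_part p * scalar_part q)"
definition "r *\<^sub>R p = Unitization (r *\<^sub>R alg_part p) (r *\<^sub>R scalar_part p)"
definition "norm p = max (onorm (left_op p)) (cmod (scalar_part p))"
definition "dist p q = norm (p - q :: 'a unitization)"
definition "sgn p = inverse (norm p) *\<^sub>R (p :: 'a unitization)"
definition "uniformity = (INF e\<in>{0 <..}. principal {(x, y :: 'a unitization). dist x y < e})"
definition
  "open (U :: 'a unitization set) \<longleftrightarrow>
    (\<forall>x\<in>U. eventually (\<lambda>(x', y). x' = x \<longrightarrow> y \<in> U) uniformity)"

lemmas unitization_ops =
  zero_unitization_def one_unitization_def plus_unitization_def minus_unitization_def
  uminus_unitization_def times_unitization_def scaleR_unitization_def

lemma left_op_simps:
  "left_op (p + q) = (\<lambda>b. left_op p b + left_op q b)"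
  "left_op (p * q) = left_op p \<circ> left_op q"
  "left_op (r *\<^sub>R p) = (\<lambda>b. r *\<^sub>R left_op p b)"
  "left_op 1 = (\<lambda>b. b)"
  "left_op 0 = (\<lambda>b. 0)"
  by (simp_all add: fun_eq_iff left_op_def unitization_ops algebra_simps scaleC_simps
      scaleR_scaleC scaleR_conv_of_real)

lemma onorm_left_op_nonneg: "0 \<le> onorm (left_op p)"
  by (simp add: onorm_pos_le bounded_linear_left_op)

lemma onorm_left_op_mult_le: "onorm (left_op (p * q)) \<le> onorm (left_op p) * onorm (left_op q)"
  unfolding left_op_simps by (intro onorm_compose bounded_linear_left_op)

instance
proof
  fix p q r :: "'a unitization" and s t :: real
  show "p + q + r = p + (q + r)" "p + q = q + p" "0 + p = p" "- p + p = 0" "p - q = p + - q"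
    by (simp_all add: unitization_ops)
  show "s *\<^sub>R (p + q) = s *\<^sub>R p + s *\<^sub>R q" "(s + t) *\<^sub>R p = s *\<^sub>R p + t *\<^sub>R p"
      "s *\<^sub>R t *\<^sub>R p = (s * t) *\<^sub>R p" "1 *\<^sub>R p = p"
    by (simp_all add: unitization_ops algebra_simps)
  show "p * q * r = p * (q * r)" "(p + q) * r = p * r + q * r" "p * (q + r) = p * q + p * r"
      "1 * p = p" "p * 1 = p" "(0::'a unitization) \<noteq> 1"
    by (simp_all add: unitization_ops algebra_simps scaleC_simps)
  show "s *\<^sub>R p * q = s *\<^sub>R (p * q)" "p * s *\<^sub>R q = s *\<^sub>R (p * q)"
    by (simp_all add: unitization_ops algebra_simps scaleC_simps scaleR_scaleC scaleR_conv_of_real)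
  show "dist p q = norm (p - q)" "sgn p = inverse (norm p) *\<^sub>R p"
    by (simp_all add: dist_unitization_def sgn_unitization_def)
  show "uniformity = (INF e\<in>{0 <..}. principal {(x, y :: 'a unitization). dist x y < e})"
    by (rule uniformity_unitization_def)
  show "open U \<longleftrightarrow> (\<forall>x\<in>U. eventually (\<lambda>(x', y). x' = x \<longrightarrow> y \<in> U) uniformity)"
    for U :: "'a unitization set"
    by (rule open_unitization_def)
  show "norm p = 0 \<longleftrightarrow> p = 0"
  proof
    assume "norm p = 0"
    then have "onorm (left_op p) \<le> 0" and z: "scalar_part p = 0"
      by (auto simp: norm_unitization_def max_def split: if_splits)
    then have "norm (alg_part p) \<le> 0"
      using norm_alg_part_le [of p] by (metis add_0_right norm_zero order_trans)
    with z show "p = 0"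
      by (cases p) (simp add: zero_unitization_def)
  next
    assume "p = 0"
    then show "norm p = 0"
      by (simp add: norm_unitization_def left_op_simps onorm_zero) (simp add: unitization_ops)
  qed
  show "norm (p + q) \<le> norm p + norm q"
    unfolding norm_unitization_def left_op_simps
    using onorm_triangle [OF bounded_linear_left_op bounded_linear_left_op, of p q]
      norm_triangle_ineq [of "scalar_part p" "scalar_part q"]
    by (auto simp: plus_unitization_def)
  show "norm (s *\<^sub>R p) = \<bar>s\<bar> * norm p"
    unfolding norm_unitization_def left_op_simps
    by (simp add: onorm_scaleR [OF bounded_linear_left_op] scaleR_unitization_def max_mult_distrib_left)
  show "norm (p * q) \<le> norm p * norm q"
  proof -
    have "onorm (left_op p) * onorm (left_op q) \<le> norm p * norm q"
        "cmod (scalar_part p) * cmod (scalar_part q) \<le> norm p * norm q"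
      unfolding norm_unitization_def
      by (intro mult_mono; simp add: onorm_left_op_nonneg le_max_iff_disj)+
    then show ?thesis
      using onorm_left_op_mult_le [of p q]
      unfolding norm_unitization_def [of "p * q"]
      by (simp add: norm_mult) (simp add: times_unitization_def norm_mult)
  qed
  show "norm (1 :: 'a unitization) = 1"
  proof -
    have "onorm (left_op (1 :: 'a unitization)) \<le> 1"
      by (rule onorm_bound) (simp_all add: left_op_simps)
    then show ?thesis
      by (simp add: norm_unitization_def one_unitization_def)
  qed
qed

end

section \<open>Completeness and the \<open>C*\<close>-identity in the unitization\<close>

instance unitization :: (cstar_algebra) banach
proof
  fix X :: "nat \<Rightarrow> 'a unitization"
  assume "Cauchy X"
  \<comment> \<open>The norm is equivalent to the sum of the norms of the two parts, so Cauchy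
    sequences and limits can be treated part by part.\<close>
  have bd: "norm (scalar_part p) \<le> norm p" "norm (alg_part p) \<le> 2 * norm p"
      "norm p \<le> norm (alg_part p) + norm (scalar_part p)" for p :: "'a unitization"
    using norm_alg_part_le [of p] onorm_left_op_le [of p] by (auto simp: norm_unitization_def)
  have "Cauchy (\<lambda>n. scalar_part (X n))"
  proof (rule CauchyI)
    fix e :: real assume "e > 0"
    then obtain M where "\<forall>m\<ge>M. \<forall>n\<ge>M. norm (X m - X n) < e"
      using \<open>Cauchy X\<close> by (auto simp: Cauchy_def dist_norm)
    then show "\<exists>M. \<forall>m\<ge>M. \<forall>n\<ge>M. norm (scalar_part (X m) - scalar_part (X n)) < e"
      using bd(1) by (metis minus_unitization_def unitization.sel(2) order_le_less_trans)
  qed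
  then obtain z where z: "(\<lambda>n. scalar_part (X n)) \<longlonglongrightarrow> z"
    using Cauchy_convergent convergent_def by blast
  have "Cauchy (\<lambda>n. alg_part (X n))"
  proof (rule CauchyI)
    fix e :: real assume "e > 0"
    then obtain M where "\<forall>m\<ge>M. \<forall>n\<ge>M. norm (X m - X n) < e / 2"
      using \<open>Cauchy X\<close> by (auto simp: Cauchy_def dist_norm dest!: spec [of _ "e / 2"])
    then have "\<forall>m\<ge>M. \<forall>n\<ge>M. 2 * norm (X m - X n) < e" by (simp add: mult.commute)
    then show "\<exists>M. \<forall>m\<ge>M. \<forall>n\<ge>M. norm (alg_part (X m) - alg_part (X n)) < e"
      using bd(2) by (metis minus_unitization_def unitization.sel(1) order_le_less_trans)
  qed
  then obtain a where a: "(\<lambda>n. alg_part (X n)) \<longlonglongrightarrow> a"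
    using Cauchy_convergent convergent_def by blast
  have lim: "(\<lambda>n. norm (alg_part (X n) - a) + norm (scalar_part (X n) - z)) \<longlonglongrightarrow> 0"
    using tendsto_add [OF tendsto_norm_zero tendsto_norm_zero, OF LIM_zero LIM_zero, OF a z] by simp
  have "norm (X n - Unitization a z) \<le> norm (alg_part (X n) - a) + norm (scalar_part (X n) - z)" for n
    using bd(3) [of "X n - Unitization a z"] by (simp add: minus_unitization_def)
  then have "(\<lambda>n. X n - Unitization a z) \<longlonglongrightarrow> 0"
    by (rule Lim_null_comparison [OF always_eventually [OF allI] lim])
  then show "convergent X"
    by (auto simp: convergent_def dest: LIM_zero_cancel)
qed

instantiation unitization :: (cstar_algebra) cstar_algebra
begin

definition "c *\<^sub>C p = Unitization (c *\<^sub>C alg_part p) (c * scalar_part p)"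
definition "adj p = Unitization (adj (alg_part p)) (cnj (scalar_part p))"

text \<open>For each \<open>b\<close>, the \<open>C*\<close>-identity in \<open>A\<close> turns
  \<open>(norm (left_op p b))^2\<close> into the norm of
  \<open>adj b * left_op (adj p * p) b\<close>.\<close>

lemma onorm_left_op_square_le: "(onorm (left_op p))\<^sup>2 \<le> onorm (left_op (adj p * p))"
proof -
  have "onorm (left_op p) \<le> sqrt (onorm (left_op (adj p * p)))"
  proof (rule onorm_bound)
    fix b
    have "adj (left_op p b) * left_op p b = adj b * left_op (adj p * p) b"
      by (simp add: left_op_def times_unitization_def adj_unitization_def adj_simps algebra_simps
          scaleC_simps)
    then have "(norm (left_op p b))\<^sup>2 = norm (adj b * left_op (adj p * p) b)"
      by (simp flip: cstar_identity)
    also have "\<dots> \<le> norm b * (onorm (left_op (adj p * p)) * norm b)"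
      using norm_left_op_le [of "adj p * p" b]
      by (intro order_trans [OF norm_mult_ineq]) (simp add: mult_left_mono)
    finally have "(norm (left_op p b))\<^sup>2 \<le> onorm (left_op (adj p * p)) * (norm b)\<^sup>2"
      by (simp add: power2_eq_square algebra_simps)
    then show "norm (left_op p b) \<le> sqrt (onorm (left_op (adj p * p))) * norm b"
      by (metis real_le_rsqrt real_sqrt_mult real_sqrt_abs abs_norm_cancel)
  qed (simp add: onorm_left_op_nonneg)
  then have "(onorm (left_op p))\<^sup>2 \<le> (sqrt (onorm (left_op (adj p * p))))\<^sup>2"
    by (intro power_mono onorm_left_op_nonneg)
  then show ?thesis
    by (simp add: onorm_left_op_nonneg)
qed

lemma onorm_left_op_adj_le: "onorm (left_op p) \<le> onorm (left_op (adj p))"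
proof (cases "onorm (left_op p) = 0")
  case False
  then have "onorm (left_op p) > 0"
    using onorm_left_op_nonneg [of p] by simp
  moreover have "onorm (left_op p) * onorm (left_op p) \<le> onorm (left_op (adj p)) * onorm (left_op p)"
    using onorm_left_op_square_le [of p] onorm_left_op_mult_le [of "adj p" p]
    by (simp add: power2_eq_square)
  ultimately show ?thesis by simp
qed (simp add: onorm_left_op_nonneg)

lemma onorm_left_op_adj_mult: "onorm (left_op (adj p * p)) = (onorm (left_op p))\<^sup>2"
proof -
  have "adj (adj p) = p" by (simp add: adj_unitization_def adj_simps)
  then have "onorm (left_op (adj p)) \<le> onorm (left_op p)"
    using onorm_left_op_adj_le [of "adj p"] by simp
  then have "onorm (left_op (adj p)) * onorm (left_op p) \<le> (onorm (left_op p))\<^sup>2"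
    by (simp add: power2_eq_square mult_right_mono onorm_left_op_nonneg)
  then show ?thesis
    using onorm_left_op_square_le [of p] onorm_left_op_mult_le [of "adj p" p] by simp
qed

instance
proof
  fix p q :: "'a unitization" and c d :: complex and s :: real
  show "c *\<^sub>C (p + q) = c *\<^sub>C p + c *\<^sub>C q" "(c + d) *\<^sub>C p = c *\<^sub>C p + d *\<^sub>C p"
      "c *\<^sub>C d *\<^sub>C p = (c * d) *\<^sub>C p" "s *\<^sub>R p = complex_of_real s *\<^sub>C p"
      "(c *\<^sub>C p) * q = c *\<^sub>C (p * q)" "p * (c *\<^sub>C q) = c *\<^sub>C (p * q)"
      "adj (adj p) = p" "adj (p + q) = adj p + adj q" "adj (c *\<^sub>C p) = cnj c *\<^sub>C adj p"
      "adj (p * q) = adj q * adj p"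
    by (simp_all add: unitization_ops adj_unitization_def scaleC_unitization_def adj_simps
        algebra_simps scaleC_simps scaleR_scaleC scaleR_conv_of_real)
  have le: "onorm (left_op (c *\<^sub>C p)) \<le> cmod c * onorm (left_op p)" for c and p :: "'a unitization"
  proof (rule onorm_bound)
    fix b
    have "left_op (c *\<^sub>C p) b = c *\<^sub>C left_op p b"
      by (simp add: left_op_def scaleC_unitization_def scaleC_simps)
    then show "norm (left_op (c *\<^sub>C p) b) \<le> cmod c * onorm (left_op p) * norm b"
      using norm_left_op_le [of p b] by (simp add: norm_scaleC mult_left_mono mult.assoc)
  qed (simp add: onorm_left_op_nonneg)
  have "onorm (left_op (c *\<^sub>C p)) = cmod c * onorm (left_op p)"
  proof (cases "c = 0")
    case True
    with le [of c p] onorm_left_op_nonneg [of "c *\<^sub>C p"] show ?thesis by simp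
  next
    case False
    then have "inverse c *\<^sub>C c *\<^sub>C p = p"
      by (cases p) (simp add: scaleC_unitization_def scaleC_scaleC flip: mult.assoc)
    with le [of "inverse c" "c *\<^sub>C p"] False
    have "cmod c * onorm (left_op p) \<le> onorm (left_op (c *\<^sub>C p))"
      by (simp add: norm_divide divide_simps mult.commute)
    with le [of c p] show ?thesis by simp
  qed
  then show "norm (c *\<^sub>C p) = cmod c * norm p"
    by (simp add: norm_unitization_def norm_mult max_mult_distrib_left scaleC_unitization_def)
  show "norm (adj p * p) = (norm p)\<^sup>2"
  proof -
    have "norm (adj p * p) = max ((onorm (left_op p))\<^sup>2) ((cmod (scalar_part p))\<^sup>2)"
      unfolding norm_unitization_def onorm_left_op_adj_mult
      by (simp add: times_unitization_def adj_unitization_def norm_mult power2_eq_square)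
    then show ?thesis
      using onorm_left_op_nonneg [of p]
      by (auto simp: norm_unitization_def max_def power2_le_iff_abs_le)
  qed
qed

end

class unital_cstar_algebra = cstar_algebra + real_normed_algebra_1

instance unitization :: (cstar_algebra) unital_cstar_algebra ..

section \<open>The positive cone of a unital \<open>C\<^sup>*\<close>-algebra\<close>

lemma adj_one [simp]: "adj (1::'a::unital_cstar_algebra) = 1"
  using adj_mult [of "adj (1::'a)" 1] by (simp add: adj_adj)

text \<open>The iteration \<open>q = (u + q\<^sup>2) / 2\<close> converges to \<open>1 - (1 - u)\<^sup>1\<^sup>/\<^sup>2\<close>.\<close>

primrec sqrt_iter :: "'a::real_normed_algebra \<Rightarrow> nat \<Rightarrow> 'a" where
  "sqrt_iter u 0 = 0"
| "sqrt_iter u (Suc n) = (1 / 2) *\<^sub>R (u + sqrt_iter u n * sqrt_iter u n)"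

lemma sqrt_iter_real_bounds: "0 \<le> sqrt_iter (1::real) n \<and> sqrt_iter (1::real) n \<le> 1"
proof (induction n)
  case (Suc n)
  then have "sqrt_iter (1::real) n * sqrt_iter 1 n \<le> 1 * 1"
    by (intro mult_mono) auto
  with Suc show ?case by simp
qed simp

text \<open>The iterates are polynomials in \<open>u\<close> with nonnegative coefficients, so the
  scalar iteration at \<open>1\<close> majorizes them.\<close>

lemma norm_sqrt_iter_le:
  assumes "norm u \<le> 1"
  shows "norm (sqrt_iter u n) \<le> sqrt_iter 1 n"
proof (induction n)
  case (Suc n)
  have "norm (u + sqrt_iter u n * sqrt_iter u n) \<le> norm u + norm (sqrt_iter u n) * norm (sqrt_iter u n)"
    by (intro norm_triangle_le add_mono norm_mult_ineq order_refl)
  also have "\<dots> \<le> 1 + sqrt_iter 1 n * sqrt_iter 1 n"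
    using Suc assms sqrt_iter_real_bounds [of n] by (intro add_mono mult_mono) auto
  finally show ?case by simp
qed simp

lemma norm_sqrt_iter_step_le:
  assumes "norm u \<le> 1"
  shows "norm (sqrt_iter u (Suc n) - sqrt_iter u n) \<le> sqrt_iter 1 (Suc n) - sqrt_iter 1 n"
proof (induction n)
  case (Suc n)
  define p q r s where "p = sqrt_iter u (Suc n)" and "q = sqrt_iter u n"
    and "r = sqrt_iter (1::real) (Suc n)" and "s = sqrt_iter (1::real) n"
  note defs = this
  have bds: "norm p \<le> r" "norm q \<le> s" "norm (p - q) \<le> r - s"
    using Suc norm_sqrt_iter_le [OF assms] unfolding defs by blast+
  then have "0 \<le> r" "0 \<le> s"
    using norm_ge_zero order_trans by blast+
  have "s \<le> r"
    using bds(3) norm_ge_zero [of "p - q"] by linarith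
  \<comment> \<open>The factorization of \<open>p * p - q * q\<close> used here holds in any ring;
    for the real iteration it makes the final bound an equality.\<close>
  have "sqrt_iter u (Suc (Suc n)) - p = (1 / 2) *\<^sub>R (p * (p - q) + (p - q) * q)"
    by (simp add: p_def q_def algebra_simps)
  then have "norm (sqrt_iter u (Suc (Suc n)) - p) \<le> (1 / 2) * (norm p * norm (p - q) + norm (p - q) * norm q)"
    by (simp add: norm_triangle_le add_mono norm_mult_ineq)
  also have "\<dots> \<le> (1 / 2) * (r * (r - s) + (r - s) * s)"
    using bds \<open>0 \<le> r\<close> \<open>0 \<le> s\<close> \<open>s \<le> r\<close> by (intro mult_left_mono add_mono mult_mono) auto
  also have "\<dots> = sqrt_iter 1 (Suc (Suc n)) - r"
    by (simp add: r_def s_def algebra_simps)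
  finally show ?case by (simp only: p_def r_def)
qed (use assms in simp)

lemma convergent_sqrt_iter:
  fixes u :: "'a::{real_normed_algebra, banach}"
  assumes "norm u \<le> 1"
  shows "convergent (sqrt_iter u)"
proof -
  have le: "norm (sqrt_iter u (m + k) - sqrt_iter u m) \<le> sqrt_iter 1 (m + k) - sqrt_iter 1 m" for m k
  proof (induction k)
    case (Suc k)
    then show ?case
      using norm_sqrt_iter_step_le [OF assms, of "m + k"]
        norm_triangle_ineq [of "sqrt_iter u (m + k) - sqrt_iter u m" "sqrt_iter u (Suc (m + k)) - sqrt_iter u (m + k)"]
      by (simp del: sqrt_iter.simps)
  qed simp
  have "incseq (sqrt_iter (1::real))"
  proof (rule incseq_SucI)
    fix n
    have "0 \<le> sqrt_iter (1::real) (Suc n) - sqrt_iter 1 n"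
      by (rule order_trans [OF norm_ge_zero norm_sqrt_iter_step_le [OF order_eq_refl [OF norm_one]]])
    then show "sqrt_iter (1::real) n \<le> sqrt_iter 1 (Suc n)" by (simp only: diff_ge_0_iff_ge)
  qed
  then have "convergent (sqrt_iter (1::real))"
    using sqrt_iter_real_bounds by (intro Bseq_monoseq_convergent BseqI' [of _ 1])
      (auto simp: incseq_imp_monoseq)
  then have C: "Cauchy (sqrt_iter (1::real))"
    by (simp add: Cauchy_convergent_iff)
  have "Cauchy (sqrt_iter u)"
  proof (rule metric_CauchyI)
    fix e :: real assume "e > 0"
    then obtain M where M: "\<And>m n. m \<ge> M \<Longrightarrow> n \<ge> M \<Longrightarrow> dist (sqrt_iter (1::real) m) (sqrt_iter 1 n) < e"
      using metric_CauchyD [OF C \<open>e > 0\<close>] by blast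
    have less: "norm (sqrt_iter u n - sqrt_iter u m) < e" if "M \<le> m" "m \<le> n" for m n
      using le [of m "n - m"] that M [of n m] by (auto simp: dist_real_def)
    then show "\<exists>M. \<forall>m\<ge>M. \<forall>n\<ge>M. dist (sqrt_iter u m) (sqrt_iter u n) < e"
      unfolding dist_norm by (metis less norm_minus_commute nle_le)
  qed
  then show ?thesis by (rule Cauchy_convergent)
qed

text \<open>The root is \<open>1 - q\<close> for the limit \<open>q\<close> of the iteration.
  Whatever commutes with \<open>x\<close> commutes with the iterates, hence with the root; this
  replaces functional calculus.\<close>

lemma sqrt_near_one:
  fixes x :: "'a::unital_cstar_algebra"
  assumes x: "adj x = x" "norm (1 - x) \<le> 1"
  obtains c where "adj c = c" "c * c = x" "norm (1 - c) \<le> 1" "\<And>y. x * y = y * x \<Longrightarrow> c * y = y * c"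
proof -
  let ?q = "sqrt_iter (1 - x)"
  obtain q where q: "?q \<longlonglongrightarrow> q"
    using convergent_sqrt_iter [OF x(2)] by (auto simp: convergent_def)
  have "(\<lambda>n. ?q (Suc n)) \<longlonglongrightarrow> (1 / 2) *\<^sub>R (1 - x + q * q)"
    unfolding sqrt_iter.simps by (intro tendsto_intros q)
  with q have "q = (1 / 2) *\<^sub>R (1 - x + q * q)"
    using LIMSEQ_Suc LIMSEQ_unique by blast
  then have "2 *\<^sub>R q = 2 *\<^sub>R ((1 / 2) *\<^sub>R (1 - x + q * q))"
    by (rule arg_cong)
  then have "q + q = 1 - x + q * q"
    by (simp add: scaleR_2)
  then have sq: "(1 - q) * (1 - q) = x"
    by (simp add: algebra_simps)
  have "adj (?q n) = ?q n" for n
    by (induction n) (simp_all add: adj_simps x)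
  with tendsto_adj [OF q] q have "adj q = q"
    by (simp add: LIMSEQ_unique)
  have "norm (?q n) \<le> 1" for n
    using norm_sqrt_iter_le [OF x(2), of n] sqrt_iter_real_bounds [of n] by linarith
  with tendsto_norm [OF q] have "norm q \<le> 1"
    by (meson LIMSEQ_le_const2)
  have comm: "q * y = y * q" if y: "x * y = y * x" for y
  proof -
    have "?q n * y = y * ?q n" for n
    proof (induction n)
      case (Suc n)
      then have "?q n * ?q n * y = y * (?q n * ?q n)"
        by (metis mult.assoc)
      then have "(1 - x + ?q n * ?q n) * y = y * (1 - x + ?q n * ?q n)"
        using y by (simp only: distrib_left distrib_right left_diff_distrib right_diff_distrib
            mult_1_left mult_1_right)
      then show ?case by simp
    qed simp
    moreover have "(\<lambda>n. ?q n * y) \<longlonglongrightarrow> q * y" "(\<lambda>n. y * ?q n) \<longlonglongrightarrow> y * q"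
      by (intro tendsto_intros q)+
    ultimately show ?thesis by (simp add: LIMSEQ_unique)
  qed
  show thesis
  proof (rule that)
    show "adj (1 - q) = 1 - q" by (simp add: adj_diff \<open>adj q = q\<close>)
    show "norm (1 - (1 - q)) \<le> 1" by (simp add: \<open>norm q \<le> 1\<close>)
    show "(1 - q) * y = y * (1 - q)" if "x * y = y * x" for y
      using comm [OF that] by (simp add: left_diff_distrib right_diff_distrib)
  qed (rule sq)
qed

text \<open>For self-adjoint \<open>x\<close> the inequality says that the spectrum lies in the
  interval from \<open>0\<close> to \<open>2 * norm x\<close>. This form makes sums easy to handle;
  \<open>positive_elements_iff\<close> relates it to the spectral definition.\<close>

definition positive :: "'a::unital_cstar_algebra \<Rightarrow> bool" where
  "positive x \<longleftrightarrow> adj x = x \<and> norm (norm x *\<^sub>R 1 - x) \<le> norm x"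

lemma positive_self_adjoint: "positive x \<Longrightarrow> adj x = x"
  by (simp add: positive_def)

text \<open>\<open>w = c + i d\<close> satisfies \<open>adj w * w = m\<close>, so
  \<open>norm w = sqrt m\<close>, and \<open>c\<close> is the real part of \<open>w\<close>.\<close>

lemma norm_le_of_sum_squares:
  fixes c d :: "'a::unital_cstar_algebra"
  assumes "adj c = c" "adj d = d" "c * d = d * c" "c * c + d * d = m *\<^sub>R 1" "0 \<le> m"
  shows "norm c \<le> sqrt m"
proof -
  define w where "w = c + \<i> *\<^sub>C d"
  have "adj w * w = c * c + d * d"
    using assms(1-3) by (simp add: w_def adj_simps algebra_simps scaleC_simps)
  then have "(norm w)\<^sup>2 = m"
    using assms(4,5) cstar_identity [of w] by simp
  then have "norm w = sqrt m"
    by (metis norm_ge_zero real_sqrt_unique)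
  moreover have "2 *\<^sub>R c = w + adj w"
    using assms(1,2) by (simp add: w_def adj_simps scaleC_simps scaleR_2)
  then have "2 * norm c \<le> norm w + norm (adj w)"
    using norm_triangle_ineq [of w "adj w"] by (metis abs_numeral norm_scaleR)
  ultimately show ?thesis by simp
qed

text \<open>After scaling to norm 1, \<open>b\<close> commutes with a root \<open>d\<close> of
  \<open>1 - b * b\<close> and their squares sum to \<open>1\<close>. Hence
  \<open>norm d \<le> 1\<close>, which bounds \<open>1 - b * b = d * d\<close>.\<close>

lemma positive_square:
  fixes c :: "'a::unital_cstar_algebra"
  assumes c: "adj c = c"
  shows "positive (c * c)"
proof (cases "c = 0")
  case False
  define M where "M = norm c"
  then have "M > 0" using False by simp
  define b where "b = (1 / M) *\<^sub>R c"
  have b: "adj b = b" "norm b = 1" "c = M *\<^sub>R b"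
    using c \<open>M > 0\<close> by (simp_all add: b_def adj_simps) (simp add: M_def)
  then have "norm (b * b) = 1"
    by (simp add: norm_self_adjoint_square)
  with b(1) have "adj (1 - b * b) = 1 - b * b" "norm (1 - (1 - b * b)) \<le> 1"
    by (simp_all add: adj_simps)
  from sqrt_near_one [OF this] obtain d where d: "adj d = d" "d * d = 1 - b * b"
      "\<And>y. (1 - b * b) * y = y * (1 - b * b) \<Longrightarrow> d * y = y * d"
    by blast
  have db: "d * b = b * d"
    by (rule d(3)) (simp add: left_diff_distrib right_diff_distrib mult.assoc)
  have "norm d \<le> sqrt 1"
    by (rule norm_le_of_sum_squares [OF d(1) b(1) db]) (simp_all add: d(2))
  then have "norm (d * d) \<le> 1"
    using norm_self_adjoint_square [OF d(1)] by (simp add: power_le_one)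
  moreover have "(M * M) *\<^sub>R 1 - c * c = (M * M) *\<^sub>R (d * d)"
    by (simp add: b(3) d(2) algebra_simps)
  ultimately have "norm ((M * M) *\<^sub>R 1 - c * c) \<le> M * M"
    using \<open>M > 0\<close> by (simp add: mult_left_le)
  then show ?thesis
    using c by (simp add: positive_def adj_simps norm_self_adjoint_square power2_eq_square M_def)
qed (simp add: positive_def)

lemma sqrt_exists_aux:
  fixes x :: "'a::unital_cstar_algebra"
  assumes x: "adj x = x" "norm (t *\<^sub>R 1 - x) \<le> t"
  obtains c where "adj c = c" "c * c = x" "norm (sqrt t *\<^sub>R 1 - c) \<le> sqrt t"
    "\<And>y. x * y = y * x \<Longrightarrow> c * y = y * c"
proof (cases "t = 0")
  case True
  with x have "x = 0" by simp
  with True show thesis by (intro that [of 0]) simp_all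
next
  case False
  with order_trans [OF norm_ge_zero x(2)] have "t > 0" by simp
  then have "t *\<^sub>R 1 - x = t *\<^sub>R (1 - (1 / t) *\<^sub>R x)"
    by (simp add: algebra_simps)
  with x(2) \<open>t > 0\<close> have "norm (1 - (1 / t) *\<^sub>R x) \<le> 1"
    by simp
  moreover have "adj ((1 / t) *\<^sub>R x) = (1 / t) *\<^sub>R x"
    by (simp add: adj_scaleR x(1))
  ultimately obtain d where d: "adj d = d" "d * d = (1 / t) *\<^sub>R x" "norm (1 - d) \<le> 1"
      "\<And>y. ((1 / t) *\<^sub>R x) * y = y * ((1 / t) *\<^sub>R x) \<Longrightarrow> d * y = y * d"
    using sqrt_near_one [of "(1 / t) *\<^sub>R x"] by blast
  have "sqrt t *\<^sub>R 1 - sqrt t *\<^sub>R d = sqrt t *\<^sub>R (1 - d)"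
    by (simp add: algebra_simps)
  then have "norm (sqrt t *\<^sub>R 1 - sqrt t *\<^sub>R d) \<le> sqrt t"
    using d(3) \<open>t > 0\<close> by (simp add: mult_left_le)
  show thesis
  proof (rule that)
    show "adj (sqrt t *\<^sub>R d) = sqrt t *\<^sub>R d"
      by (simp add: adj_scaleR d(1))
    show "(sqrt t *\<^sub>R d) * (sqrt t *\<^sub>R d) = x"
      using \<open>t > 0\<close> by (simp add: d(2))
    show "(sqrt t *\<^sub>R d) * y = y * (sqrt t *\<^sub>R d)" if "x * y = y * x" for y
      using d(4) [of y] that by simp
  qed fact
qed

text \<open>Such an \<open>x\<close> is the square of a self-adjoint element, and squares satisfy
  the bound with \<open>t = norm x\<close>. So any \<open>t\<close> may serve as witness, as sums
  require.\<close>

lemma positiveI: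
  assumes "adj x = x" "norm (t *\<^sub>R 1 - x) \<le> t"
  shows "positive x"
  using sqrt_exists_aux [OF assms] positive_square by metis

lemma positive_sqrt:
  assumes "positive x"
  obtains c where "positive c" "c * c = x" "\<And>y. x * y = y * x \<Longrightarrow> c * y = y * c"
  using assms sqrt_exists_aux [of x "norm x"] positiveI unfolding positive_def by metis

lemma positive_add:
  assumes "positive x" "positive y"
  shows "positive (x + y)"
proof (rule positiveI)
  have "norm ((norm x *\<^sub>R 1 - x) + (norm y *\<^sub>R 1 - y)) \<le> norm x + norm y"
    using assms by (intro norm_triangle_le add_mono) (simp_all add: positive_def)
  then show "norm ((norm x + norm y) *\<^sub>R 1 - (x + y)) \<le> norm x + norm y"
    by (simp add: algebra_simps)
qed (use assms in \<open>simp add: positive_def adj_simps\<close>)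

lemma positive_scaleR:
  assumes "positive x" "0 \<le> r"
  shows "positive (r *\<^sub>R x)"
proof (rule positiveI)
  have "(r * norm x) *\<^sub>R 1 - r *\<^sub>R x = r *\<^sub>R (norm x *\<^sub>R 1 - x)"
    by (simp add: algebra_simps)
  then show "norm ((r * norm x) *\<^sub>R 1 - r *\<^sub>R x) \<le> r * norm x"
    using assms by (simp add: positive_def mult_left_mono)
qed (use assms in \<open>simp add: positive_def adj_simps\<close>)

lemma positive_norm_minus:
  assumes "adj x = x"
  shows "positive (norm x *\<^sub>R 1 - x)"
  by (rule positiveI [of _ "norm x"]) (simp_all add: adj_simps assms)

text \<open>\<open>p\<close> and \<open>m - p\<close> have commuting roots whose squares sum to
  \<open>m\<close>, so \<open>norm_le_of_sum_squares\<close> bounds the root of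
  \<open>p\<close>.\<close>

lemma positive_norm_le:
  fixes p :: "'a::unital_cstar_algebra"
  assumes "positive p" "positive (m *\<^sub>R 1 - p)" "0 \<le> m"
  shows "norm p \<le> m"
proof -
  obtain c where c: "positive c" "c * c = p" "\<And>y. p * y = y * p \<Longrightarrow> c * y = y * c"
    using positive_sqrt [OF assms(1)] by metis
  obtain e where e: "positive e" "e * e = m *\<^sub>R 1 - p" "\<And>y. (m *\<^sub>R 1 - p) * y = y * (m *\<^sub>R 1 - p) \<Longrightarrow> e * y = y * e"
    using positive_sqrt [OF assms(2)] by metis
  have "p * c = c * p"
    unfolding c(2) [symmetric] by (rule mult.assoc)
  then have ce: "c * e = e * c"
    using e(3) [of c] by (simp add: left_diff_distrib right_diff_distrib)
  have "norm c \<le> sqrt m"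
    by (rule norm_le_of_sum_squares [OF positive_self_adjoint positive_self_adjoint ce _ assms(3)])
      (simp_all add: c(1,2) e(1,2))
  then have "(norm c)\<^sup>2 \<le> m"
    using assms(3) by (metis norm_ge_zero power_mono real_sqrt_pow2)
  then show ?thesis
    using c(1,2) norm_self_adjoint_square [of c] by (simp add: positive_self_adjoint)
qed

lemma positive_norm_mono:
  assumes "positive p" "positive (q - p)"
  shows "norm p \<le> norm q"
proof (rule positive_norm_le)
  have "adj q = q"
    using assms by (simp add: positive_def adj_simps)
  from positive_add [OF positive_norm_minus [OF this] assms(2)]
  show "positive (norm q *\<^sub>R 1 - p)"
    by simp
qed (use assms in simp_all)

lemma positive_antisym:
  assumes "positive x" "positive (- x)"
  shows "x = 0"
  using positive_norm_mono [of x 0] assms by simp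

subsection \<open>Positivity and invertibility\<close>

definition invertible_elt :: "'a::monoid_mult \<Rightarrow> bool" where
  "invertible_elt x \<longleftrightarrow> (\<exists>y. x * y = 1 \<and> y * x = 1)"

lemma neumann_inverse:
  fixes x :: "'a::{real_normed_algebra_1, banach}"
  assumes "norm x < 1"
  obtains y where "(1 - x) * y = 1" "y * (1 - x) = 1" "norm y \<le> 1 / (1 - norm x)"
proof -
  define y where "y = (\<Sum>n. x ^ n)"
  have sm: "summable (\<lambda>n. x ^ n)"
    by (rule complete_algebra_summable_geometric [OF assms])
  have "y = (\<Sum>n. x ^ Suc n) + 1"
    unfolding y_def using suminf_split_head [OF sm] by simp
  moreover have "(\<Sum>n. x ^ Suc n) = x * y"
    unfolding y_def using suminf_mult [OF sm, of x] by simp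
  moreover have "(\<Sum>n. x ^ Suc n) = y * x"
    unfolding y_def using suminf_mult2 [OF sm, of x] by (simp add: power_commutes)
  ultimately have y: "y = x * y + 1" "y = y * x + 1" by simp_all
  have "norm y \<le> norm (x * y) + 1"
    using norm_triangle_ineq [of "x * y" 1] by (simp flip: y(1))
  also have "\<dots> \<le> norm x * norm y + 1"
    by (simp add: norm_mult_ineq)
  finally have "norm y \<le> 1 / (1 - norm x)"
    using assms by (simp add: field_simps)
  moreover have "(1 - x) * y = 1" "y * (1 - x) = 1"
    using y by (simp_all add: algebra_simps)
  ultimately show thesis by (intro that)
qed

text \<open>With \<open>t = norm a + s\<close>, \<open>a + s = t (1 - x)\<close> where
  \<open>norm x \<le> norm a / t < 1\<close>; the Neumann series applies, and
  \<open>1 - norm a / t = s / t\<close> yields the bound.\<close>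

lemma positive_inverse:
  fixes a :: "'a::unital_cstar_algebra"
  assumes "positive a" "0 < s"
  obtains y where "(a + s *\<^sub>R 1) * y = 1" "y * (a + s *\<^sub>R 1) = 1" "norm y \<le> 1 / s"
proof -
  define t where "t = norm a + s"
  define x where "x = (1 / t) *\<^sub>R (norm a *\<^sub>R 1 - a)"
  have "t > 0" using assms(2) by (simp add: t_def add_nonneg_pos)
  have nx: "norm x \<le> norm a / t"
    using assms(1) \<open>t > 0\<close> by (simp add: x_def positive_def divide_right_mono)
  have "norm a / t < 1"
    using assms(2) \<open>t > 0\<close> by (simp add: t_def)
  with nx obtain y where y: "(1 - x) * y = 1" "y * (1 - x) = 1" "norm y \<le> 1 / (1 - norm x)"
    using neumann_inverse [of x] by force
  have eq: "a + s *\<^sub>R 1 = t *\<^sub>R (1 - x)"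
    using \<open>t > 0\<close> by (simp add: x_def algebra_simps) (simp add: t_def algebra_simps)
  have "norm y \<le> 1 / (1 - norm a / t)"
    using y(3) nx \<open>norm a / t < 1\<close> by (smt (verit) frac_le)
  also have "\<dots> = t / s"
    using \<open>t > 0\<close> assms(2) by (simp add: t_def field_simps)
  finally have "norm ((1 / t) *\<^sub>R y) \<le> 1 / s"
    using \<open>t > 0\<close> by (simp add: field_simps)
  then show thesis
    using y(1,2) \<open>t > 0\<close> by (intro that [of "(1 / t) *\<^sub>R y"]) (simp_all add: eq)
qed

text \<open>
  The set of shifts \<open>s \<ge> 0\<close> for which \<open>a + s\<close> is positive is closed, and it is open away from \<open>0\<close>:
  an invertible positive \<open>x = c\<^sup>2\<close> with inverse \<open>v\<close> satisfies
  \<open>x - \<delta> = (c e)\<^sup>2\<close>, where \<open>e\<close> is the square root of \<open>1 - \<delta> v\<close>.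
\<close>

lemma positive_of_invertible:
  fixes a :: "'a::unital_cstar_algebra"
  assumes a: "adj a = a" and inv: "\<And>s. 0 < s \<Longrightarrow> invertible_elt (a + s *\<^sub>R 1)"
  shows "positive a"
proof -
  define S where "S = {s. 0 \<le> s \<and> positive (a + s *\<^sub>R 1)}"
  have "S = {0..} \<inter> {s. norm (norm (a + s *\<^sub>R 1) *\<^sub>R 1 - (a + s *\<^sub>R 1)) \<le> norm (a + s *\<^sub>R 1)}"
    by (auto simp: S_def positive_def adj_simps a)
  moreover have "closed {s. norm (norm (a + s *\<^sub>R 1) *\<^sub>R 1 - (a + s *\<^sub>R 1)) \<le> norm (a + s *\<^sub>R 1)}"
    by (intro closed_Collect_le continuous_intros)
  ultimately have "closed S" by (simp add: closed_Int)
  have "norm a \<in> S"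
    using positive_norm_minus [of "- a"] a by (simp add: S_def adj_simps add.commute)
  moreover have "bdd_below S" by (auto simp: S_def)
  ultimately have mem: "Inf S \<in> S"
    using \<open>closed S\<close> closed_contains_Inf by blast
  have "Inf S = 0"
  proof (rule ccontr)
    assume "Inf S \<noteq> 0"
    define s where "s = Inf S"
    define x where "x = a + s *\<^sub>R 1"
    have "s > 0" "positive x"
      using mem \<open>Inf S \<noteq> 0\<close> by (auto simp: S_def s_def x_def)
    obtain c where c: "positive c" "c * c = x" "\<And>y. x * y = y * x \<Longrightarrow> c * y = y * c"
      using positive_sqrt [OF \<open>positive x\<close>] by metis
    obtain v where v: "x * v = 1" "v * x = 1"
      using inv [OF \<open>s > 0\<close>] by (auto simp: x_def invertible_elt_def)
    have x: "adj x = x" using \<open>positive x\<close> by (rule positive_self_adjoint)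
    have "adj v = adj v * (x * v)" using v by simp
    also have "\<dots> = adj (x * v) * v" by (simp add: adj_mult x mult.assoc)
    finally have "adj v = v" using v by simp
    have "v \<noteq> 0" using v by auto
    have cv: "c * v = v * c"
      using c(3) [of v] v by simp
    \<comment> \<open>\<open>\<delta> \<le> s\<close> keeps the new shift nonnegative;
      \<open>\<delta> * norm v \<le> 1\<close> puts \<open>1 - \<delta> v\<close> in the range of
      \<open>sqrt_near_one\<close>.\<close>
    define \<delta> where "\<delta> = min s (1 / norm v)"
    have \<delta>: "0 < \<delta>" "\<delta> \<le> s" "\<delta> * norm v \<le> 1"
      using \<open>s > 0\<close> \<open>v \<noteq> 0\<close> by (auto simp: \<delta>_def min_def field_simps)
    have "adj (1 - \<delta> *\<^sub>R v) = 1 - \<delta> *\<^sub>R v" "norm (1 - (1 - \<delta> *\<^sub>R v)) \<le> 1"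
      using \<delta> \<open>adj v = v\<close> by (simp_all add: adj_simps)
    from sqrt_near_one [OF this] obtain e where e: "adj e = e" "e * e = 1 - \<delta> *\<^sub>R v"
        "\<And>y. (1 - \<delta> *\<^sub>R v) * y = y * (1 - \<delta> *\<^sub>R v) \<Longrightarrow> e * y = y * e"
      by blast
    have ce: "e * c = c * e"
      using e(3) [of c] cv by (simp add: left_diff_distrib right_diff_distrib)
    have "(c * e) * (c * e) = (c * c) * (e * e)"
      using ce by (metis mult.assoc)
    also have "\<dots> = x - \<delta> *\<^sub>R 1"
      using v by (simp add: c(2) e(2) right_diff_distrib)
    finally have "positive (x - \<delta> *\<^sub>R 1)"
      using positive_square [of "c * e"] ce c(1) e(1) by (simp add: adj_simps positive_self_adjoint)
    then have "s - \<delta> \<in> S"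
      using \<delta> by (simp add: S_def x_def algebra_simps)
    then show False
      using cInf_lower [OF _ \<open>bdd_below S\<close>] \<delta>(1) unfolding s_def by fastforce
  qed
  with mem show ?thesis by (simp add: S_def)
qed

text \<open>The inverse \<open>z\<close> of \<open>x * y\<close> commutes with \<open>y\<close>, so
  \<open>y * z\<close> inverts \<open>x\<close> on both sides.\<close>

lemma invertible_elt_factor:
  assumes "invertible_elt (x * y)" "x * y = y * x"
  shows "invertible_elt x"
proof -
  obtain z where z: "(x * y) * z = 1" "z * (x * y) = 1"
    using assms(1) by (auto simp: invertible_elt_def)
  have "z * y = z * y * (x * y * z)" using z by simp
  also have "\<dots> = z * (x * y) * (y * z)" using assms(2) by (metis mult.assoc)
  finally have "z * y = y * z" using z by simp
  then show ?thesis
    using z assms(2) unfolding invertible_elt_def by (metis mult.assoc)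
qed

lemma invertible_elt_mult:
  assumes "invertible_elt x" "invertible_elt y"
  shows "invertible_elt (x * y)"
proof -
  obtain u v where "x * u = 1" "u * x = 1" "y * v = 1" "v * y = 1"
    using assms by (auto simp: invertible_elt_def)
  then have "(x * y) * (v * u) = 1" "(v * u) * (x * y) = 1"
    by (metis mult.assoc mult_1_left)+
  then show ?thesis unfolding invertible_elt_def by blast
qed

text \<open>Multiplying by the conjugate factor gives \<open>b * b + (Im \<mu>)^2\<close> with
  \<open>b = c - Re \<mu>\<close>, a positive element shifted by a positive number.\<close>

lemma invertible_self_adjoint_minus_scalar:
  fixes c :: "'a::unital_cstar_algebra"
  assumes c: "adj c = c" and "Im \<mu> \<noteq> 0"
  shows "invertible_elt (c - \<mu> *\<^sub>C 1)"
proof (rule invertible_elt_factor)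
  define b where "b = c - Re \<mu> *\<^sub>R 1"
  have "\<mu> = Re \<mu> + \<i> * Im \<mu>" "cnj \<mu> = Re \<mu> - \<i> * Im \<mu>"
    by (simp_all add: complex_eq_iff)
  then have "\<mu> *\<^sub>C (1::'a) = Re \<mu> *\<^sub>R 1 + (\<i> * Im \<mu>) *\<^sub>C 1"
      "cnj \<mu> *\<^sub>C (1::'a) = Re \<mu> *\<^sub>R 1 - (\<i> * Im \<mu>) *\<^sub>C 1"
    unfolding scaleR_scaleC by (metis scaleC_add_left, metis scaleC_diff_left)
  then have eqs: "c - \<mu> *\<^sub>C 1 = b - (\<i> * Im \<mu>) *\<^sub>C 1" "c - cnj \<mu> *\<^sub>C 1 = b + (\<i> * Im \<mu>) *\<^sub>C 1"
    by (simp_all add: b_def)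
  show "(c - \<mu> *\<^sub>C 1) * (c - cnj \<mu> *\<^sub>C 1) = (c - cnj \<mu> *\<^sub>C 1) * (c - \<mu> *\<^sub>C 1)"
    by (simp add: algebra_simps scaleC_simps)
  have "(c - \<mu> *\<^sub>C 1) * (c - cnj \<mu> *\<^sub>C 1) = b * b + (Im \<mu>)\<^sup>2 *\<^sub>R 1"
    unfolding eqs scaleR_scaleC
    by (simp add: algebra_simps scaleC_simps power2_eq_square)
  moreover have "positive (b * b)"
    using c by (intro positive_square) (simp add: b_def adj_simps)
  ultimately show "invertible_elt ((c - \<mu> *\<^sub>C 1) * (c - cnj \<mu> *\<^sub>C 1))"
    using positive_inverse [of "b * b" "(Im \<mu>)\<^sup>2"] assms(2) unfolding invertible_elt_def
    by (metis zero_less_power2)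
qed

text \<open>With \<open>c * c = a\<close> and \<open>\<mu>\<close> a root of \<open>z\<close>,
  \<open>a - z = (c - \<mu>) (c + \<mu>)\<close>; \<open>\<mu>\<close> is not real, as otherwise
  \<open>z\<close> would be nonnegative.\<close>

lemma positive_spectrum:
  fixes a :: "'a::unital_cstar_algebra"
  assumes "positive a" "z \<notin> complex_of_real ` {0..}"
  shows "invertible_elt (a - z *\<^sub>C 1)"
proof -
  obtain c where c: "positive c" "c * c = a"
    using positive_sqrt [OF assms(1)] by metis
  define \<mu> where "\<mu> = csqrt z"
  have \<mu>: "\<mu> * \<mu> = z"
    by (simp add: \<mu>_def flip: power2_eq_square)
  have "Im \<mu> \<noteq> 0"
  proof
    assume "Im \<mu> = 0"
    then have "z = complex_of_real (Re \<mu> * Re \<mu>)"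
      using \<mu> by (auto simp: complex_eq_iff)
    then have "z \<in> complex_of_real ` {0..}"
      by (rule image_eqI) simp
    with assms(2) show False ..
  qed
  have "a - z *\<^sub>C 1 = (c - \<mu> *\<^sub>C 1) * (c - (- \<mu>) *\<^sub>C 1)"
    using c(2) \<mu> by (simp add: algebra_simps scaleC_simps)
  then show ?thesis
    using \<open>Im \<mu> \<noteq> 0\<close> c(1) by (simp only:)
      (intro invertible_elt_mult invertible_self_adjoint_minus_scalar; simp add: positive_self_adjoint)
qed

subsection \<open>Positivity of \<open>y\<^sup>* y\<close>\<close>

text \<open>
  With \<open>h = y\<^sup>* y\<close>, \<open>g = \<bar>h\<bar>\<close> and \<open>m = g - h\<close>, the element \<open>c = y m\<close> satisfies \<open>c\<^sup>* c \<le> 0\<close>. Hence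
  \<open>c c\<^sup>* = (c c\<^sup>* + c\<^sup>* c) - c\<^sup>* c \<ge> 0\<close>, whereas \<open>c c\<^sup>* \<le> 0\<close> because \<open>c c\<^sup>*\<close> and \<open>c\<^sup>* c\<close> have
  the same nonzero spectrum. So \<open>c = 0\<close>, which forces \<open>m = 0\<close>.
\<close>

lemma positive_adj_mult:
  fixes y :: "'a::unital_cstar_algebra"
  shows "positive (adj y * y)"
proof -
  define h where "h = adj y * y"
  have h: "adj h = h" by (simp add: h_def adj_simps)
  obtain g where g: "positive g" "g * g = h * h" "\<And>z. (h * h) * z = z * (h * h) \<Longrightarrow> g * z = z * g"
    using positive_sqrt [OF positive_square [OF h]] by metis
  obtain q where q: "positive q" "q * q = g" "\<And>z. g * z = z * g \<Longrightarrow> q * z = z * q"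
    using positive_sqrt [OF g(1)] by metis
  have gh: "g * h = h * g"
    by (rule g(3)) (rule mult.assoc)
  define m where "m = g - h"
  have m: "adj m = m"
    using g(1) h by (simp add: m_def adj_simps positive_self_adjoint)
  have gm: "g * m = m * g"
    by (simp add: m_def left_diff_distrib right_diff_distrib gh)
  have qm: "q * m = m * q"
    by (rule q(3) [OF gm])
  have mm: "m * m = 2 *\<^sub>R (g * m)"
    by (simp add: m_def left_diff_distrib right_diff_distrib gh g(2) scaleR_2)
  have hm: "h * m = - (g * m)"
    by (simp add: m_def right_diff_distrib gh g(2))
  \<comment> \<open>From \<open>h * m = - (g * m)\<close> one gets
    \<open>adj c * c = - (m * g * m)\<close>; the root \<open>q\<close> of \<open>g\<close> exhibits
    \<open>m * g * m\<close> as the square of \<open>k\<close>.\<close>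
  define k where "k = q * m"
  have k: "adj k = k"
    using q(1) m qm by (simp add: k_def adj_simps positive_self_adjoint)
  have kk: "k * k = m * g * m"
    unfolding k_def q(2) [symmetric] by (metis qm mult.assoc)
  define c where "c = y * m"
  have "adj c * c = m * (h * m)"
    by (simp add: c_def h_def adj_mult m mult.assoc)
  then have cc: "adj c * c = - (k * k)"
    by (simp add: hm kk mult.assoc)
  \<comment> \<open>Up to sign these are twice the real and imaginary parts of \<open>c\<close>;
    their squares sum to \<open>2 (c * adj c + adj c * c)\<close>.\<close>
  define p r where "p = c + adj c" and "r = \<i> *\<^sub>C (c - adj c)"
  have "adj p = p" "adj r = r"
    by (simp_all add: p_def r_def adj_simps scaleC_simps add.commute)
  then have "positive ((1 / 2) *\<^sub>R (p * p + r * r) + k * k)"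
    by (intro positive_add positive_scaleR positive_square k) simp_all
  moreover have "p * p + r * r = 2 *\<^sub>R (c * adj c + adj c * c)"
    by (simp add: p_def r_def algebra_simps scaleC_simps scaleR_2)
  ultimately have pos: "positive (c * adj c)"
    by (simp add: cc)
  have neg: "positive (- (c * adj c))"
  proof (rule positive_of_invertible)
    fix s :: real assume "0 < s"
    obtain v where v: "(k * k + s *\<^sub>R 1) * v = 1" "v * (k * k + s *\<^sub>R 1) = 1"
      using positive_inverse [OF positive_square [OF k] \<open>0 < s\<close>] by metis
    \<comment> \<open>Consequences of \<open>adj c * c = - (k * k)\<close>; they make
      \<open>1 + c * v * adj c\<close> equal to \<open>s\<close> times the inverse of
      \<open>s - c * adj c\<close>.\<close>
    have ccv: "adj c * c * v = s *\<^sub>R v - 1" "v * (adj c * c) = s *\<^sub>R v - 1"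
      using v by (simp_all add: cc algebra_simps add_eq_0_iff)
    have "(- (c * adj c) + s *\<^sub>R 1) * (1 + c * v * adj c)
        = s *\<^sub>R 1 - c * adj c + s *\<^sub>R (c * v * adj c) - c * (adj c * c * v) * adj c"
      by (simp add: algebra_simps)
    also have "\<dots> = s *\<^sub>R 1"
      unfolding ccv by (simp add: algebra_simps)
    finally have 1: "(- (c * adj c) + s *\<^sub>R 1) * (1 + c * v * adj c) = s *\<^sub>R 1" .
    have "(1 + c * v * adj c) * (- (c * adj c) + s *\<^sub>R 1)
        = s *\<^sub>R 1 - c * adj c + s *\<^sub>R (c * v * adj c) - c * (v * (adj c * c)) * adj c"
      by (simp add: algebra_simps)
    also have "\<dots> = s *\<^sub>R 1"
      unfolding ccv by (simp add: algebra_simps)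
    finally have 2: "(1 + c * v * adj c) * (- (c * adj c) + s *\<^sub>R 1) = s *\<^sub>R 1" .
    from 1 2 \<open>0 < s\<close> show "invertible_elt (- (c * adj c) + s *\<^sub>R 1)"
      unfolding invertible_elt_def by (intro exI [of _ "(1 / s) *\<^sub>R (1 + c * v * adj c)"]) simp
  qed (simp add: adj_simps)
  have "c = 0"
    using positive_antisym [OF pos neg] cstar_identity' [of c] by simp
  then have "m * g * m = 0"
    using cc kk by simp
  \<comment> \<open>\<open>m * m = 2 g m\<close> makes \<open>m * g * m\<close> half of the cube of
    \<open>m\<close>, and a nilpotent self-adjoint element vanishes.\<close>
  then have "m * (m * m) = 0"
    by (simp add: mm mult.assoc)
  then have "(m * m) * (m * m) = 0"
    by (metis mult.assoc mult_zero_right)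
  then have "m * m = 0"
    by (intro self_adjoint_square_eq_0 [of "m * m"]) (simp_all add: adj_mult m)
  then have "m = 0"
    by (rule self_adjoint_square_eq_0 [OF m])
  then show ?thesis
    using g(1) by (simp add: m_def h_def)
qed

section \<open>Division by powers of a positive element\<close>

lemma adj_power: "adj (x ^ n) = adj (x::'a::unital_cstar_algebra) ^ n"
  by (induction n) (simp_all add: adj_mult power_commutes)

lemma power_mult_distrib_commuting:
  fixes x y :: "'a::monoid_mult"
  assumes "x * y = y * x"
  shows "(x * y) ^ n = x ^ n * y ^ n"
proof (induction n)
  case (Suc n)
  have "y * x ^ n = x ^ n * y"
    using assms by (metis power_commuting_commutes)
  with Suc show ?case by (simp add: mult.assoc) (simp flip: mult.assoc)
qed simp

text \<open>Moves norm estimates between \<open>y\<close> and a root \<open>d\<close> of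
  \<open>adj y * y\<close>, in the form that \<open>factor_through_power\<close> asks for.\<close>

lemma norm_mult_eq_of_adj_mult_eq:
  fixes d y :: "'a::cstar_algebra"
  assumes "adj d * d = adj y * y"
  shows "norm (d * z) = norm (y * z)"
proof -
  have "adj (d * z) * (d * z) = adj (y * z) * (y * z)"
    using assms by (simp add: adj_mult mult.assoc) (simp flip: mult.assoc)
  then have "(norm (d * z))\<^sup>2 = (norm (y * z))\<^sup>2"
    by (simp flip: cstar_identity)
  then show ?thesis by simp
qed

text \<open>The quotient \<open>u\<close> is the limit of \<open>d (k + \<epsilon>)\<^sup>-\<^sup>n\<close> as \<open>\<epsilon>\<close> tends to \<open>0\<close>.\<close>

lemma factor_through_power:
  fixes k :: "'a::unital_cstar_algebra"
  assumes k: "positive k" and le: "\<And>z. norm (d * z) \<le> K * norm (k ^ Suc n * z)"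
  obtains u where "d = u * k ^ n"
proof -
  define \<epsilon> where "\<epsilon> j = inverse (real (Suc j))" for j
  have \<epsilon>: "\<epsilon> j > 0" for j by (simp add: \<epsilon>_def)
  have \<epsilon>0: "\<epsilon> \<longlonglongrightarrow> 0" unfolding \<epsilon>_def by (rule LIMSEQ_inverse_real_of_nat)
  have "\<exists>y. (k + \<epsilon> j *\<^sub>R 1) * y = 1 \<and> y * (k + \<epsilon> j *\<^sub>R 1) = 1 \<and> norm y \<le> 1 / \<epsilon> j" for j
    using positive_inverse [OF k \<epsilon> [of j]] by metis
  then obtain e where e: "\<And>j. (k + \<epsilon> j *\<^sub>R 1) * e j = 1" "\<And>j. e j * (k + \<epsilon> j *\<^sub>R 1) = 1"
      "\<And>j. norm (e j) \<le> 1 / \<epsilon> j"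
    by metis
  define f where "f j = k * e j" for j
  have f: "f j = 1 - \<epsilon> j *\<^sub>R e j" for j
    using e(1) [of j] by (simp add: f_def algebra_simps)
  have ke: "k * e j = e j * k" for j
    using e(1,2) [of j] by (simp add: algebra_simps) (metis add_right_cancel)
  have norm_f: "norm (f j) \<le> 2" for j
  proof -
    have "norm (f j) \<le> norm (1::'a) + norm (\<epsilon> j *\<^sub>R e j)"
      unfolding f by (rule norm_triangle_ineq4)
    moreover have "norm (\<epsilon> j *\<^sub>R e j) \<le> 1"
      using e(3) [of j] \<epsilon> [of j] by (simp add: field_simps)
    ultimately show ?thesis by simp
  qed
  \<comment> \<open>\<open>f j\<close> need not tend to \<open>1\<close>, but
    \<open>k * f j ^ m\<close> tends to \<open>k\<close>, because
    \<open>k - k * f j = \<epsilon> j f j\<close> with \<open>f j\<close> bounded. The extra factor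
    of \<open>k\<close> in the hypothesis on \<open>d\<close> pays for this.\<close>
  have kf: "norm (k - k * f j ^ m) \<le> \<epsilon> j * 2 ^ Suc m" for j m
  proof (induction m)
    case (Suc m)
    have "k * f j = k - \<epsilon> j *\<^sub>R f j"
      by (subst f) (simp add: f_def right_diff_distrib)
    then have "k * f j ^ Suc m = k * f j ^ m - \<epsilon> j *\<^sub>R f j ^ Suc m"
      by (simp add: left_diff_distrib flip: mult.assoc)
    then have eq: "k - k * f j ^ Suc m = (k - k * f j ^ m) + \<epsilon> j *\<^sub>R f j ^ Suc m"
      by simp
    have "norm (k - k * f j ^ Suc m) \<le> norm (k - k * f j ^ m) + \<epsilon> j * norm (f j ^ Suc m)"
      unfolding eq
      using norm_triangle_ineq [of "k - k * f j ^ m" "\<epsilon> j *\<^sub>R f j ^ Suc m"] \<epsilon> [of j] by simp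
    moreover have "norm (f j ^ Suc m) \<le> 2 ^ Suc m"
      using norm_f [of j] by (intro order_trans [OF norm_power_ineq] power_mono) simp_all
    then have "\<epsilon> j * norm (f j ^ Suc m) \<le> \<epsilon> j * 2 ^ Suc m"
      using \<epsilon> [of j] by (intro mult_left_mono) simp_all
    ultimately show ?case
      using Suc by simp
  qed (simp add: less_imp_le [OF \<epsilon>])
  have ke_pow: "k ^ n * e j ^ n = f j ^ n" "e j ^ n * k ^ n = f j ^ n" for j
    using power_mult_distrib_commuting [OF ke [of j], of n]
      power_mult_distrib_commuting [OF ke [of j, symmetric], of n] ke [of j]
    by (simp_all add: f_def)
  have le': "norm (d * z) \<le> \<bar>K\<bar> * norm (k ^ Suc n * z)" for z
    using order_trans [OF le mult_right_mono [OF abs_ge_self norm_ge_zero]] .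
  define u where "u j = d * e j ^ n" for j
  define C where "C = \<bar>K\<bar> * 2 ^ Suc n"
  have diff: "norm (u i - u j) \<le> C * \<epsilon> i + C * \<epsilon> j" for i j
  proof -
    have "norm (u i - u j) = norm (d * (e i ^ n - e j ^ n))"
      by (simp add: u_def right_diff_distrib)
    also have "\<dots> \<le> \<bar>K\<bar> * norm (k ^ Suc n * (e i ^ n - e j ^ n))"
      by (rule le')
    also have "k ^ Suc n * (e i ^ n - e j ^ n) = (k - k * f j ^ n) - (k - k * f i ^ n)"
      by (simp add: right_diff_distrib mult.assoc ke_pow)
    also have "\<bar>K\<bar> * norm \<dots> \<le> \<bar>K\<bar> * (\<epsilon> j * 2 ^ Suc n + \<epsilon> i * 2 ^ Suc n)"
      by (intro mult_left_mono order_trans [OF norm_triangle_ineq4] add_mono kf) simp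
    finally show ?thesis by (simp add: C_def algebra_simps)
  qed
  have C0: "(\<lambda>j. C * \<epsilon> j) \<longlonglongrightarrow> 0"
    using tendsto_mult_right_zero [OF \<epsilon>0] .
  have "Cauchy u"
  proof (rule metric_CauchyI)
    fix r :: real assume "r > 0"
    then have "eventually (\<lambda>j. C * \<epsilon> j < r / 2) sequentially"
      using order_tendstoD(2) [OF C0, of "r / 2"] by simp
    then obtain M where M: "\<And>j. j \<ge> M \<Longrightarrow> C * \<epsilon> j < r / 2"
      by (auto simp: eventually_sequentially)
    have "dist (u i) (u j) < r" if "i \<ge> M" "j \<ge> M" for i j
      using diff [of i j] M [OF that(1)] M [OF that(2)] by (simp add: dist_norm)
    then show "\<exists>M. \<forall>i\<ge>M. \<forall>j\<ge>M. dist (u i) (u j) < r" by blast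
  qed
  then obtain w where w: "u \<longlonglongrightarrow> w"
    using Cauchy_convergent convergent_def by blast
  have "norm (d - u j * k ^ n) \<le> norm (k ^ n) * (C * \<epsilon> j)" for j
  proof -
    have "norm (d - u j * k ^ n) = norm (d * (1 - f j ^ n))"
      by (simp add: u_def right_diff_distrib mult.assoc ke_pow)
    also have "\<dots> \<le> \<bar>K\<bar> * norm (k ^ Suc n * (1 - f j ^ n))"
      by (rule le')
    also have "k ^ Suc n * (1 - f j ^ n) = k ^ n * (k - k * f j ^ n)"
      by (simp add: right_diff_distrib mult.assoc power_commutes) (simp add: power_commutes flip: mult.assoc)
    also have "\<bar>K\<bar> * norm \<dots> \<le> \<bar>K\<bar> * (norm (k ^ n) * (\<epsilon> j * 2 ^ Suc n))"
      by (intro mult_left_mono order_trans [OF norm_mult_ineq] kf) simp_all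
    finally show ?thesis by (simp add: C_def algebra_simps)
  qed
  then have "(\<lambda>j. d - u j * k ^ n) \<longlonglongrightarrow> 0"
    by (rule Lim_null_comparison [OF always_eventually [OF allI] tendsto_mult_right_zero [OF C0]])
  moreover have "(\<lambda>j. d - u j * k ^ n) \<longlonglongrightarrow> d - w * k ^ n"
    by (intro tendsto_intros w)
  ultimately have "d - w * k ^ n = 0"
    by (rule LIMSEQ_unique [symmetric])
  then show thesis by (intro that [of w]) simp
qed

section \<open>Semiprime ideals\<close>

text \<open>
  \<open>A\<close> is the original algebra inside its unitization; semiprimeness is only available for its
  elements, whereas \<open>I\<close> absorbs products with the whole unitization.
\<close>

locale semiprime_ideal_in =
  fixes A I :: "'a::unital_cstar_algebra set"
  assumes mult_mem_A: "x \<in> A \<Longrightarrow> b * x \<in> A"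
    and sqrt_mem_A: "c * c \<in> A \<Longrightarrow> c \<in> A"
    and subset: "I \<subseteq> A"
    and add_mem: "x \<in> I \<Longrightarrow> y \<in> I \<Longrightarrow> x + y \<in> I"
    and mult_left_mem: "x \<in> I \<Longrightarrow> b * x \<in> I"
    and mult_right_mem: "x \<in> I \<Longrightarrow> x * b \<in> I"
    and semiprime: "x \<in> A \<Longrightarrow> (\<And>p. p \<in> A \<Longrightarrow> x * p * x \<in> I) \<Longrightarrow> x \<in> I"
begin

lemma scaleC_mem: "x \<in> I \<Longrightarrow> c *\<^sub>C x \<in> I"
  using mult_left_mem [of x "c *\<^sub>C 1"] by (simp add: mult_scaleC_left)

lemma diff_mem: "x \<in> I \<Longrightarrow> y \<in> I \<Longrightarrow> x - y \<in> I"
  using add_mem [of x "- y"] scaleC_mem [of y "- 1"] by (simp add: scaleC_minus_left)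

text \<open>Polarization with \<open>s = adj p\<close> and \<open>t = 1\<close> writes
  \<open>p\<close> as a combination of elements \<open>adj w * w\<close>. Here \<open>w\<close>
  ranges over the whole unital algebra, since \<open>1 + s\<close> may leave
  \<open>A\<close>.\<close>

lemma semiprime_positive:
  assumes "x \<in> A" and sq: "\<And>w. x * (adj w * w) * x \<in> I"
  shows "x \<in> I"
proof (rule semiprime [OF \<open>x \<in> A\<close>])
  fix p :: 'a
  define q where "q w = x * (adj w * w) * x" for w
  let ?s = "adj p"
  have "4 *\<^sub>C (x * p * x) = x * (4 *\<^sub>C (adj ?s * 1)) * x"
    by (simp add: adj_adj mult_scaleC_left mult_scaleC_right)
  also have "\<dots> = (q (1 + ?s) - q (1 - ?s)) + \<i> *\<^sub>C (q (1 + \<i> *\<^sub>C ?s) - q (1 - \<i> *\<^sub>C ?s))"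
    unfolding polarization q_def
    by (simp only: distrib_left distrib_right left_diff_distrib right_diff_distrib
        mult_scaleC_left mult_scaleC_right)
  also have "\<dots> \<in> I"
    using sq unfolding q_def by (intro add_mem diff_mem scaleC_mem)
  finally have "(1 / 4) *\<^sub>C 4 *\<^sub>C (x * p * x) \<in> I"
    by (rule scaleC_mem)
  then show "x * p * x \<in> I" by (simp add: scaleC_scaleC)
qed

lemma power_descent:
  assumes k: "positive k" "k \<in> A" and mem: "k ^ (2 * n) \<in> I"
  shows "k ^ Suc n \<in> I"
proof (rule semiprime_positive)
  show "k ^ Suc n \<in> A"
    using mult_mem_A [OF k(2), of "k ^ n"] by (simp add: power_commutes)
  fix w
  define y where "y = w * k ^ Suc n"
  have adj_k: "adj (k ^ m) = k ^ m" for m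
    using k(1) by (simp add: adj_power positive_self_adjoint)
  obtain d where d: "positive d" "d * d = adj y * y"
    using positive_sqrt [OF positive_adj_mult] by metis
  \<comment> \<open>\<open>d\<close> and \<open>y\<close> have the same norms on right multiples;
    factoring out of \<open>d\<close> then costs one power of \<open>k\<close>.\<close>
  have "norm (d * z) \<le> norm w * norm (k ^ Suc n * z)" for z
  proof -
    have "norm (d * z) = norm (y * z)"
      using d by (intro norm_mult_eq_of_adj_mult_eq) (simp add: positive_self_adjoint)
    then show ?thesis
      using norm_mult_ineq [of w "k ^ Suc n * z"] by (simp only: y_def mult.assoc)
  qed
  then obtain u where u: "d = u * k ^ n"
    by (rule factor_through_power [OF k(1)])
  \<comment> \<open>In this order the two powers of \<open>k\<close> meet in the middle and form
    \<open>k ^ (2 * n)\<close>.\<close>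
  have "d * d = d * adj d"
    using d(1) by (simp add: positive_self_adjoint)
  also have "\<dots> = u * k ^ (2 * n) * adj u"
    by (simp add: u adj_mult adj_k mult_2 power_add mult.assoc)
  also have "\<dots> \<in> I"
    by (intro mult_left_mem mult_right_mem mem)
  finally show "k ^ Suc n * (adj w * w) * k ^ Suc n \<in> I"
    by (simp only: d(2) y_def adj_mult adj_k mult.assoc)
qed

text \<open>With \<open>b = l\<^sup>4\<close>, the previous lemma leads from \<open>l\<^sup>8\<close> to \<open>l\<^sup>5\<close> and from \<open>l\<^sup>6\<close> to \<open>l\<^sup>4\<close>.\<close>

lemma sqrt_mem:
  assumes b: "positive b" and mem: "b * b \<in> I"
  shows "b \<in> I"
proof -
  obtain c where c: "positive c" "c * c = b"
    using positive_sqrt [OF b] by metis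
  obtain l where l: "positive l" "l * l = c"
    using positive_sqrt [OF c(1)] by metis
  have b_eq: "b = l ^ 4"
    by (simp add: c(2) [symmetric] l(2) [symmetric] power_numeral_reduce mult.assoc)
  have "b \<in> A"
    using mem subset by (blast intro: sqrt_mem_A)
  then have "l \<in> A"
    using c(2) l(2) by (blast intro: sqrt_mem_A)
  have "l ^ (2 * 4) \<in> I"
    using mem by (simp add: b_eq flip: power_add)
  then have "l ^ Suc 4 \<in> I"
    by (rule power_descent [OF l(1) \<open>l \<in> A\<close>])
  then have "l * l ^ Suc 4 \<in> I"
    by (rule mult_left_mem)
  then have "l ^ (2 * 3) \<in> I"
    by (simp flip: power_Suc)
  then have "l ^ Suc 3 \<in> I"
    by (rule power_descent [OF l(1) \<open>l \<in> A\<close>])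
  then show ?thesis by (simp add: b_eq)
qed

section \<open>Factorization inside the ideal, and heredity\<close>

lemma sqrt_exists_mem:
  assumes "positive x" "x \<in> I"
  obtains c where "positive c" "c \<in> I" "c * c = x"
  using positive_sqrt [OF assms(1)] sqrt_mem assms(2) by metis

text \<open>Three successive roots of \<open>adj x * x\<close> stay in \<open>I\<close>; the first
  is \<open>k ^ 4\<close>, so \<open>norm (x * z) = norm (k ^ 4 * z)\<close>, and division leaves
  \<open>k ^ 3\<close>.\<close>

lemma factorization:
  assumes "x \<in> I"
  obtains u k where "positive k" "k \<in> I" "x = u * k ^ 3"
proof -
  obtain b where b: "positive b" "b \<in> I" "b * b = adj x * x"
    using sqrt_exists_mem [OF positive_adj_mult mult_left_mem [OF assms]] by metis
  obtain c where c: "positive c" "c \<in> I" "c * c = b"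
    using sqrt_exists_mem [OF b(1,2)] by metis
  obtain k where k: "positive k" "k \<in> I" "k * k = c"
    using sqrt_exists_mem [OF c(1,2)] by metis
  have "b = k ^ Suc 3"
    by (simp add: c(3) [symmetric] k(3) [symmetric] power_numeral_reduce mult.assoc)
  then have "norm (x * z) \<le> 1 * norm (k ^ Suc 3 * z)" for z
    using norm_mult_eq_of_adj_mult_eq [of b x z] b by (simp add: positive_self_adjoint)
  then obtain u where "x = u * k ^ 3"
    by (rule factor_through_power [OF k(1)])
  with k show thesis by (intro that)
qed

lemma adj_mem:
  assumes "x \<in> I"
  shows "adj x \<in> I"
proof -
  obtain u k where k: "positive k" "k \<in> I" "x = u * k ^ 3"
    using factorization [OF assms] .
  then have "adj x = k * (k ^ 2 * adj u)"
    by (simp add: adj_mult adj_power positive_self_adjoint power_numeral_reduce mult.assoc)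
  with k(2) show ?thesis by (simp add: mult_right_mem)
qed

lemma product_of_adj:
  assumes "x \<in> I"
  obtains s t where "s \<in> I" "t \<in> I" "x = adj s * t"
proof -
  obtain u k where k: "positive k" "k \<in> I" "x = u * k ^ 3"
    using factorization [OF assms] .
  then have "x = adj (adj (u * k)) * (k * k)"
    by (simp add: adj_adj power_numeral_reduce mult.assoc)
  moreover have "adj (u * k) \<in> I" "k * k \<in> I"
    using k(2) by (intro adj_mem mult_left_mem; assumption)+
  ultimately show thesis by (intro that)
qed

text \<open>With \<open>x = c * c = k ^ 4\<close> and \<open>a = d * d\<close>, positivity of
  \<open>adj z * (x - a) * z\<close> gives \<open>norm (d * z) \<le> norm (c * z)\<close>, where
  \<open>c = k ^ 2\<close>; so \<open>d\<close> is a left multiple of \<open>k\<close>.\<close>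

lemma hereditary_mem:
  assumes "positive a" "positive (x - a)" "x \<in> I"
  shows "a \<in> I"
proof -
  have "positive x"
    using positive_add [OF assms(1,2)] by simp
  then obtain c where c: "positive c" "c \<in> I" "c * c = x"
    using sqrt_exists_mem assms(3) by metis
  obtain k where k: "positive k" "k \<in> I" "k * k = c"
    using sqrt_exists_mem [OF c(1,2)] by metis
  obtain d where d: "positive d" "d * d = a"
    using positive_sqrt [OF assms(1)] by metis
  obtain e where e: "positive e" "e * e = x - a"
    using positive_sqrt [OF assms(2)] by metis
  have "norm (d * z) \<le> 1 * norm (k ^ Suc 1 * z)" for z
  proof -
    have "positive (adj (d * z) * (d * z))" by (rule positive_adj_mult)
    moreover have "adj (c * z) * (c * z) - adj (d * z) * (d * z) = adj z * (x - a) * z"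
      using c d by (simp add: adj_mult positive_self_adjoint algebra_simps) (simp flip: mult.assoc)
    then have "adj (c * z) * (c * z) - adj (d * z) * (d * z) = adj (e * z) * (e * z)"
      unfolding e(2) [symmetric] using e(1) by (simp add: adj_mult positive_self_adjoint mult.assoc)
    then have "positive (adj (c * z) * (c * z) - adj (d * z) * (d * z))"
      by (simp only: positive_adj_mult)
    ultimately have "(norm (d * z))\<^sup>2 \<le> (norm (c * z))\<^sup>2"
      using positive_norm_mono unfolding cstar_identity [symmetric] by blast
    then show ?thesis
      using k(3) by (simp add: power2_le_iff_abs_le)
  qed
  then obtain u where "d = u * k ^ 1"
    by (rule factor_through_power [OF k(1)])
  then have "d \<in> I"
    using k(2) by (simp add: mult_left_mem)
  then show ?thesis
    using d(2) mult_left_mem by blast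
qed

end

subsection \<open>Passing to the unitization\<close>

definition embed :: "'a::cstar_algebra \<Rightarrow> 'a unitization" where
  "embed a = Unitization a 0"

lemma inj_embed: "inj embed"
  by (simp add: inj_def embed_def)

lemma embed_simps:
  "embed a + embed b = embed (a + b)"
  "embed a - embed b = embed (a - b)"
  "embed a * embed b = embed (a * b)"
  "adj (embed a) = embed (adj a)"
  by (simp_all add: embed_def plus_unitization_def minus_unitization_def times_unitization_def
      adj_unitization_def)

lemma unitization_invertible_iff:
  "unitization_invertible (a, - z) \<longleftrightarrow> invertible_elt (embed a - z *\<^sub>C 1)"
proof -
  have "unitization_mult (a, w) q = (0, 1) \<longleftrightarrow> Unitization a w * Unitization (fst q) (snd q) = 1"
    "unitization_mult q (a, w) = (0, 1) \<longleftrightarrow> Unitization (fst q) (snd q) * Unitization a w = 1" for w q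
    by (simp_all add: unitization_mult_def times_unitization_def one_unitization_def)
  moreover have "embed a - z *\<^sub>C 1 = Unitization a (- z)"
    by (simp add: embed_def minus_unitization_def scaleC_unitization_def one_unitization_def)
  ultimately show ?thesis
    unfolding unitization_invertible_def invertible_elt_def
    by (metis fst_conv snd_conv unitization.collapse)
qed

text \<open>Forwards, \<open>- s\<close> lies outside the spectrum for every \<open>s > 0\<close>,
  so \<open>positive_of_invertible\<close> applies; backwards this is
  \<open>positive_spectrum\<close>.\<close>

lemma positive_elements_iff: "a \<in> positive_elements \<longleftrightarrow> positive (embed a)"
proof
  assume a: "a \<in> positive_elements"
  show "positive (embed a)"
  proof (rule positive_of_invertible)
    show "adj (embed a) = embed a"
      using a by (simp add: positive_elements_def embed_simps)
    fix s :: real assume "0 < s"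
    then have "complex_of_real (- s) \<notin> complex_of_real ` {0..}"
      by (auto simp del: of_real_minus)
    then have "unitization_invertible (a, - complex_of_real (- s))"
      using a unfolding positive_elements_def unitized_spectrum_def by blast
    then show "invertible_elt (embed a + s *\<^sub>R 1)"
      unfolding unitization_invertible_iff by (simp add: scaleC_minus_left scaleR_scaleC)
  qed
next
  assume a: "positive (embed a)"
  have "adj a = a"
    using positive_self_adjoint [OF a] by (simp add: embed_simps inj_eq [OF inj_embed])
  then show "a \<in> positive_elements"
    using positive_spectrum [OF a]
    by (auto simp: positive_elements_def unitized_spectrum_def unitization_invertible_iff)
qed

text \<open>Instead of the ideal generated by \<open>x\<close>, take
  \<open>J = L \<inter> R\<close>: it contains \<open>x\<close> and satisfies
  \<open>J A J \<subseteq> I\<close>. For \<open>K = J J\<close>, the products \<open>K K\<close>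
  lie in \<open>K J \<subseteq> I\<close>, so semiprimeness gives first
  \<open>K \<subseteq> I\<close> and then \<open>J \<subseteq> I\<close>.\<close>

lemma semiprime_ideal_elementwise:
  assumes I: "semiprime_ideal I" and x: "\<And>p. x * p * x \<in> I"
  shows "x \<in> I"
proof -
  have ideal: "0 \<in> I" "\<And>x y. x \<in> I \<Longrightarrow> y \<in> I \<Longrightarrow> x - y \<in> I" "\<And>a x. x \<in> I \<Longrightarrow> a * x \<in> I"
      "\<And>a x. x \<in> I \<Longrightarrow> x * a \<in> I"
    and sp: "\<And>J. is_ideal J \<Longrightarrow> ideal_mult J J \<subseteq> I \<Longrightarrow> J \<subseteq> I"
    using I by (auto simp: semiprime_ideal_def is_ideal_def)
  define L where "L = {y. \<forall>p. x * p * y \<in> I}"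
  define R where "R = {z. \<forall>y\<in>L. \<forall>p. z * p * y \<in> I}"
  define J where "J = L \<inter> R"
  have L: "is_ideal L"
    unfolding is_ideal_def L_def
    using ideal by (auto simp: right_diff_distrib simp flip: mult.assoc) (metis mult.assoc)
  have R: "is_ideal R"
    unfolding is_ideal_def R_def
    using ideal by (auto simp: left_diff_distrib) (metis mult.assoc)+
  have J: "is_ideal J"
    using L R by (auto simp: is_ideal_def J_def)
  have JJJ: "z * p * y \<in> I" if "z \<in> J" "y \<in> J" for z p y
    using that by (auto simp: J_def R_def)
  let ?K = "ideal_mult J J"
  have "is_ideal ?K"
    unfolding is_ideal_def
  proof (intro conjI ballI allI)
    fix a z assume "z \<in> ?K"
    then have "z \<in> group_closure {x * y |x y. x \<in> J \<and> y \<in> J}"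
      by (simp add: ideal_mult_def)
    then show "a * z \<in> ?K" "z * a \<in> ?K"
      unfolding ideal_mult_def
    proof (induction z)
      case (base z)
      \<comment> \<open>The base case of \<open>group_closure\<close> comprises \<open>0\<close>
        besides the generators.\<close>
      then consider "z = 0" | x y where "z = x * y" "x \<in> J" "y \<in> J" by auto
      then have "a * z \<in> insert 0 {x * y |x y. x \<in> J \<and> y \<in> J} \<and> z * a \<in> insert 0 {x * y |x y. x \<in> J \<and> y \<in> J}"
      proof cases
        case 2
        then have "a * x \<in> J" "y * a \<in> J" using J by (auto simp: is_ideal_def)
        with 2 show ?thesis by (metis (mono_tags, lifting) insertCI mem_Collect_eq mult.assoc)
      qed simp
      then show "a * z \<in> group_closure {x * y |x y. x \<in> J \<and> y \<in> J}"
          "z * a \<in> group_closure {x * y |x y. x \<in> J \<and> y \<in> J}"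
        by (auto intro: group_closure.base)
    qed (simp_all add: left_diff_distrib right_diff_distrib group_closure.diff)
  qed (simp_all add: ideal_mult_def group_closure.diff)
  moreover have "?K \<subseteq> J"
  proof
    fix z assume "z \<in> ?K"
    then show "z \<in> J"
      unfolding ideal_mult_def by induction (use J in \<open>auto simp: is_ideal_def\<close>)
  qed
  have KJ: "z * y \<in> I" if "z \<in> ?K" "y \<in> J" for z y
    using that(1) unfolding ideal_mult_def
    by induction (use JJJ ideal that(2) in \<open>auto simp: left_diff_distrib\<close>)
  have "ideal_mult ?K ?K \<subseteq> I"
  proof
    fix z assume "z \<in> ideal_mult ?K ?K"
    then show "z \<in> I"
      unfolding ideal_mult_def [of ?K ?K]
      by induction (use KJ \<open>?K \<subseteq> J\<close> ideal in auto)
  qed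
  ultimately have "?K \<subseteq> I" by (rule sp)
  with J have "J \<subseteq> I" by (rule sp)
  moreover have "x \<in> J"
    using x by (auto simp: J_def L_def R_def)
  ultimately show ?thesis by blast
qed

text \<open>In \<open>(c x) p (c x)\<close> both scalars can be moved into the factor to the right
  of the first \<open>x\<close>, which is an element of the algebra.\<close>

lemma semiprime_ideal_scaleC:
  assumes I: "semiprime_ideal I" and x: "x \<in> I"
  shows "c *\<^sub>C x \<in> I"
proof (rule semiprime_ideal_elementwise [OF I])
  fix p
  have "(c *\<^sub>C x) * p * (c *\<^sub>C x) = x * ((c * c) *\<^sub>C (p * x))"
    by (simp add: mult_scaleC_left mult_scaleC_right scaleC_scaleC mult.assoc)
  then show "(c *\<^sub>C x) * p * (c *\<^sub>C x) \<in> I"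
    using I x by (simp add: semiprime_ideal_def is_ideal_def)
qed

lemma semiprime_ideal_in_unitization:
  assumes I: "semiprime_ideal I"
  shows "semiprime_ideal_in (range embed) (embed ` I)"
proof
  have ideal: "\<And>a x. x \<in> I \<Longrightarrow> a * x \<in> I" "\<And>a x. x \<in> I \<Longrightarrow> x * a \<in> I"
      "0 \<in> I" "\<And>x y. x \<in> I \<Longrightarrow> y \<in> I \<Longrightarrow> x - y \<in> I"
    using I by (auto simp: semiprime_ideal_def is_ideal_def)
  have add: "x + y \<in> I" if "x \<in> I" "y \<in> I" for x y
    using ideal(4) [OF that(1) ideal(4) [OF ideal(3) that(2)]] by simp
  have left: "b * embed x = embed (alg_part b * x + scalar_part b *\<^sub>C x)"
    and right: "embed x * b = embed (x * alg_part b + scalar_part b *\<^sub>C x)" for b and x :: 'a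
    by (simp_all add: embed_def times_unitization_def)
  show "b * x \<in> range embed" if "x \<in> range embed" for b x :: "'a unitization"
    using that by (auto simp: left)
  \<comment> \<open>The scalar part is multiplicative, and a complex number with square
    \<open>0\<close> is \<open>0\<close>.\<close>
  show "c \<in> range embed" if "c * c \<in> range embed" for c :: "'a unitization"
  proof -
    from that have "scalar_part (c * c) = 0" by (auto simp: embed_def)
    then have "scalar_part c = 0" by (simp add: times_unitization_def)
    then show ?thesis by (cases c) (simp add: embed_def)
  qed
  show "embed ` I \<subseteq> range embed" by blast
  show "x + y \<in> embed ` I" if "x \<in> embed ` I" "y \<in> embed ` I" for x y
    using that add by (auto simp: embed_simps)
  show "b * x \<in> embed ` I" "x * b \<in> embed ` I" if "x \<in> embed ` I" for b x
    using that add ideal(1,2) semiprime_ideal_scaleC [OF I] by (auto simp: left right)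
  show "x \<in> embed ` I" if x: "x \<in> range embed" "\<And>p. p \<in> range embed \<Longrightarrow> x * p * x \<in> embed ` I" for x
  proof -
    obtain a where a: "x = embed a" using x(1) by blast
    have "a * p * a \<in> I" for p
      using x(2) [of "embed p"] by (simp add: a embed_simps inj_image_mem_iff [OF inj_embed])
    then show ?thesis
      using semiprime_ideal_elementwise [OF I] a by blast
  qed
qed

theorem corollaryB:
  fixes I :: "'a::cstar_algebra set"
  assumes "semiprime_ideal I"
  shows "positively_spanned I \<and> I = adj ` I \<and> (\<forall>c. \<forall>x\<in>I. c *\<^sub>C x \<in> I) \<and> hereditary I"
proof (intro conjI)
  interpret semiprime_ideal_in "range embed" "embed ` I"
    by (rule semiprime_ideal_in_unitization [OF assms])
  note mem_iff = inj_image_mem_iff [OF inj_embed]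
  have add: "x + y \<in> I" if "x \<in> I" "y \<in> I" for x y
    using add_mem [of "embed x" "embed y"] that by (simp add: embed_simps mem_iff)
  have diff: "x - y \<in> I" if "x \<in> I" "y \<in> I" for x y
    using diff_mem [of "embed x" "embed y"] that by (simp add: embed_simps mem_iff)
  have mult: "x * y \<in> I" if "y \<in> I" for x y
    using mult_left_mem [of "embed y" "embed x"] that by (simp add: embed_simps mem_iff)
  have adj: "adj x \<in> I" if "x \<in> I" for x
    using adj_mem [of "embed x"] that by (simp add: embed_simps mem_iff)
  show scaleC: "\<forall>c. \<forall>x\<in>I. c *\<^sub>C x \<in> I"
    using semiprime_ideal_scaleC [OF assms] by blast
  show "I = adj ` I"
    using adj by (metis adj_adj image_eqI image_subsetI subsetI subset_antisym)
  show "positively_spanned I"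
    unfolding positively_spanned_def
  proof
    show "complex_vector.span (I \<inter> positive_elements) \<subseteq> I"
    proof (rule complex_vector.span_minimal)
      have "0 \<in> I" using assms by (simp add: semiprime_ideal_def is_ideal_def)
      then show "complex_vector.subspace I"
        using add scaleC by (simp add: complex_vector.subspace_def)
    qed blast
    show "I \<subseteq> complex_vector.span (I \<inter> positive_elements)"
    proof
      fix x assume "x \<in> I"
      then have "embed x \<in> embed ` I" by blast
      then obtain s' t' where "s' \<in> embed ` I" "t' \<in> embed ` I" "embed x = adj s' * t'"
        by (rule product_of_adj)
      then obtain s t where st: "s \<in> I" "t \<in> I" "x = adj s * t"
        by (auto simp: embed_simps inj_eq [OF inj_embed])
      have sq: "adj w * w \<in> complex_vector.span (I \<inter> positive_elements)" if "w \<in> I" for w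
        using that mult positive_adj_mult [of "embed w"]
        by (intro complex_vector.span_base) (simp add: positive_elements_iff embed_simps)
      \<comment> \<open>All four \<open>w\<close> in the polarization formula are combinations of
        \<open>s\<close> and \<open>t\<close>, hence lie in \<open>I\<close>.\<close>
      have "4 *\<^sub>C x \<in> complex_vector.span (I \<inter> positive_elements)"
        unfolding st(3) polarization using st(1,2) scaleC
        by (intro complex_vector.span_add complex_vector.span_diff complex_vector.span_scale sq add diff) auto
      then have "(1 / 4) *\<^sub>C 4 *\<^sub>C x \<in> complex_vector.span (I \<inter> positive_elements)"
        by (rule complex_vector.span_scale)
      then show "x \<in> complex_vector.span (I \<inter> positive_elements)"
        by (simp add: scaleC_scaleC)
    qed
  qed
  show "hereditary I"
    unfolding hereditary_def cstar_le_def
    using hereditary_mem [of "embed _" "embed _"]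
    by (auto simp: positive_elements_iff embed_simps mem_iff)
qed

end
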